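(* Let $r \in \{1,2,\ldots,\infty\}$ and let $M \subset \mathbb{R}^N$ be a compact, embedded $C^r$ submanifold of $\mathbb{R}^N$. Let $X \subset M$ be a compact set and let $\mu$ be a Borel probability measure on $X$. Fix $k \in \mathbb{N}$ and a $C^r$ function $\phi : M \to \mathbb{R}^k$. For a linear map $L \in \mathrm{LIN}(\mathbb{R}^N,\mathbb{R}^k)$ write $\phi_L : M \to \mathbb{R}^k$, $\phi_L := \phi + L|_M$. Then the following hold for Lebesgue almost every $L \in \mathrm{LIN}(\mathbb{R}^N,\mathbb{R}^k)$: (1) if $\mathcal{H}^k(X) = 0$ and $k \geq \dim M$, then for $\mu$-a.e. $x$ there exists $C = C(x,L) \in [0,\infty)$ such that $$\|x - y\| \leq C\,\|\phi_L(x) - \phi_L(y)\| \quad \text{for every } y \in X;$$ (2) if $k > \dim M$, then for $\mu$-a.e. $x$ there exist open neighbourhoods $U$ of $x$ in $M$ and $V$ of $\phi_L(x)$ in $\mathbb{R}^k$ such that $\phi_L$ is a $C^r$ diffeomorphism between $U$ and $V \cap \phi_L(M)$.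
   Context: $\mathbb{N} = \{1,2,\ldots\}$. $\mathrm{LIN}(\mathbb{R}^N,\mathbb{R}^k)$ is the finite-dimensional linear space of linear maps $\mathbb{R}^N \to \mathbb{R}^k$, with the (unique up to normalization) Lebesgue measure class. $\mathcal{H}^k$ is the $k$-dimensional Hausdorff measure and $\|\cdot\|$ is the Euclidean norm. Part of statement (2) is that $V \cap \phi_L(M)$ is an embedded $C^r$ submanifold of $\mathbb{R}^k$. *)

theory Defs
  imports "HOL-Probability.Probability" "HOL-Library.Extended_Nat"
begin

text \<open>
  Continuous differentiability of order \<^term>\<open>n\<close>, meant for open \<^term>\<open>S\<close>: the iterated directional
  derivatives of order below \<^term>\<open>n\<close> are (Frechet) differentiable and those of order at most
  \<^term>\<open>n\<close> are continuous.
\<close>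

fun n_times_C_on :: "nat \<Rightarrow> 'a::euclidean_space set \<Rightarrow> ('a \<Rightarrow> 'b::euclidean_space) \<Rightarrow> bool" where
  "n_times_C_on 0 S f \<longleftrightarrow> continuous_on S f"
| "n_times_C_on (Suc n) S f \<longleftrightarrow>
     (\<forall>x\<in>S. f differentiable (at x)) \<and>
     (\<forall>v. n_times_C_on n S (\<lambda>x. frechet_derivative f (at x) v))"

definition Cr_on_open :: "enat \<Rightarrow> 'a::euclidean_space set \<Rightarrow> ('a \<Rightarrow> 'b::euclidean_space) \<Rightarrow> bool" where
  "Cr_on_open r S f \<longleftrightarrow> open S \<and> (\<forall>n. enat n \<le> r \<longrightarrow> n_times_C_on n S f)"

text \<open>
  A function on an arbitrary subset of a Euclidean space is \<open>C\<^sup>r\<close> if near each point of the subset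
  it is the restriction of a \<open>C\<^sup>r\<close> function defined on an open set of the ambient space. On an
  embedded \<open>C\<^sup>r\<close> submanifold this is the same as being \<open>C\<^sup>r\<close> in charts. Only the values of the
  function on the subset matter.
\<close>

definition Cr_on :: "enat \<Rightarrow> 'a::euclidean_space set \<Rightarrow> ('a \<Rightarrow> 'b::euclidean_space) \<Rightarrow> bool" where
  "Cr_on r A f \<longleftrightarrow>
     (\<forall>p\<in>A. \<exists>W g. p \<in> W \<and> Cr_on_open r W g \<and> (\<forall>x\<in>A \<inter> W. g x = f x))"

definition Cr_diffeomorphism ::
  "enat \<Rightarrow> 'a::euclidean_space set \<Rightarrow> 'b::euclidean_space set \<Rightarrow> ('a \<Rightarrow> 'b) \<Rightarrow> bool" where
  "Cr_diffeomorphism r A B f \<longleftrightarrow>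
     bij_betw f A B \<and> Cr_on r A f \<and> Cr_on r B (inv_into A f)"

text \<open>
  Embedded \<open>C\<^sup>r\<close> submanifolds (without boundary) of dimension \<^term>\<open>d\<close>, by slice charts. An
  arbitrary \<^term>\<open>d\<close>-dimensional linear subspace \<^term>\<open>T\<close> plays the role of the coordinate subspace
  \<open>\<real>\<^sup>d \<times> {0}\<close>. The dimension \<^term>\<open>d\<close> is determined by \<^term>\<open>M\<close> if \<^term>\<open>M\<close> is nonempty.
\<close>

definition embedded_Cr_submanifold :: "enat \<Rightarrow> nat \<Rightarrow> 'a::euclidean_space set \<Rightarrow> bool" where
  "embedded_Cr_submanifold r d M \<longleftrightarrow>
     (\<forall>p\<in>M. \<exists>W W' \<psi> T. open W \<and> p \<in> W \<and> open (W' :: 'a set) \<and> Cr_diffeomorphism r W W' \<psi> \<and>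
        subspace T \<and> dim T = d \<and> \<psi> ` (M \<inter> W) = T \<inter> W')"

text \<open>
  The \<^term>\<open>k\<close>-dimensional Hausdorff (outer) measure, without normalising constant. The library's
  \<^const>\<open>diameter\<close> is meaningless for unbounded sets, and the empty set must contribute \<open>0\<close> also
  for \<open>k = 0\<close>, where \<open>0 ^ 0 = 1\<close>.
\<close>

definition hausdorff_pre_measure :: "nat \<Rightarrow> real \<Rightarrow> 'a::metric_space set \<Rightarrow> ennreal" where
  "hausdorff_pre_measure k \<delta> A =
     (INF C \<in> {C :: nat \<Rightarrow> 'a set. A \<subseteq> (\<Union>i. C i) \<and> (\<forall>i. bounded (C i) \<and> diameter (C i) \<le> \<delta>)}.
        (\<Sum>i. if C i = {} then 0 else ennreal (diameter (C i) ^ k)))"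

definition hausdorff_measure :: "nat \<Rightarrow> 'a::metric_space set \<Rightarrow> ennreal" where
  "hausdorff_measure k A = (SUP \<delta> \<in> {0<..}. hausdorff_pre_measure k \<delta> A)"

text \<open>
  The map \<open>\<phi>\<^sub>L = \<phi> + L\<close>. The linear map \<open>L\<close> is given by its matrix; matrices form a Euclidean
  space, whose Lebesgue null sets are those of the space of linear maps.
\<close>

definition perturb ::
  "(real^'n \<Rightarrow> real^'k) \<Rightarrow> real^'n^'k \<Rightarrow> real^'n \<Rightarrow> real^'k" where
  "perturb \<phi> L x = \<phi> x + L *v x"

end

theory Submission
  imports Defs
begin

text \<open>
  Fix \<open>x\<close>. The matrices \<open>L\<close> in a ball with \<open>\<parallel>L v + w\<parallel> \<le> \<epsilon>\<close> form a set of measure \<open>O((\<epsilon> / \<parallel>v\<parallel>)\<^sup>k)\<close>, since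
  many translates of it by rank-one matrices are disjoint. Summing this bound over a cover of an
  \<open>H\<^sup>k\<close>-null set \<open>Y\<close> shows that almost no \<open>L\<close> has \<open>\<phi>\<^sub>L x = \<phi>\<^sub>L y\<close> for some \<open>y \<in> Y\<close> other than \<open>x\<close>.
  The same statement for a linear \<open>\<phi>\<close>, the point \<open>0\<close> and affine hyperplanes of the tangent space
  (dimension \<open>m - 1 < k\<close>) shows that \<open>\<phi>\<^sub>L\<close> is almost surely an immersion at \<open>x\<close>, hence locally
  expanding. Compactness yields one constant \<open>C\<close>, and Fubini exchanges \<open>x\<close> and \<open>L\<close>, which is (1).
  If \<open>m < k\<close> then \<open>M\<close> is itself \<open>H\<^sup>k\<close>-null, so the estimate holds with \<open>Y = M\<close>; this makes \<open>\<phi>\<^sub>L\<close> an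
  immersion at \<open>x\<close> with \<open>\<phi>\<^sub>L x\<close> away from the image of the rest of \<open>M\<close>, and (2) follows from the
  inverse function theorem.
\<close>

section \<open>Calculus of \<open>C\<^sup>n\<close> maps\<close>

text \<open>One endpoint \<open>x\<close> is frozen before \<open>L\<close> becomes random.
  Collisions between arbitrary pairs are indexed by the product of \<open>X\<close> with itself,
  whose dimension may be about twice that of \<open>X\<close>, so its covers need not be summable in
  the power \<open>k\<close>; with \<open>x\<close> fixed only covers of \<open>X\<close> are
  summed. The exponent \<open>k\<close> counts the rows of \<open>L\<close>: each row contributes
  one factor \<epsilon> / |v| to the volume of a slab. A slab absorbs a whole covering set at once,
  because \<open>\<phi>\<^sub>L\<close> varies on a set of diameter d by at most (\<Lambda> + R) d,
  with \<Lambda> a local Lipschitz constant of \<phi> and R a bound for \<open>L\<close>. The slab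
  bound degenerates as v = x - y gets short, which is why points near \<open>x\<close> are treated
  through the derivative instead. The estimate with the constant \<open>C\<close> is also the only
  property carried through Fubini. Unlike the conclusion of (2) it is visibly a Borel condition on
  the pair \<open>(x, L)\<close>, and the injectivity of the derivative needed for (2) can be
  recovered from it.\<close>

lemma n_times_C_on_cong:
  assumes "open S" "n_times_C_on n S f" "\<And>x. x \<in> S \<Longrightarrow> f x = g x"
  shows "n_times_C_on n S g"
  using assms(2,3)
proof (induction n arbitrary: f g)
  case 0
  then show ?case
    by (metis continuous_on_cong n_times_C_on.simps(1))
next
  case (Suc n)
  have d: "f differentiable at x" if "x \<in> S" for x
    using Suc.prems that by auto
  have "g differentiable at x" if "x \<in> S" for x
  proof -
    obtain D where "(f has_derivative D) (at x)"
      using d[OF \<open>x \<in> S\<close>] by (auto simp: differentiable_def)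
    then have "(g has_derivative D) (at x)"
      by (rule has_derivative_transform_within_open[OF _ assms(1) that Suc.prems(2)])
    then show ?thesis by (auto simp: differentiable_def)
  qed
  moreover have "n_times_C_on n S (\<lambda>x. frechet_derivative g (at x) v)" for v
  proof (rule Suc.IH)
    show "n_times_C_on n S (\<lambda>x. frechet_derivative f (at x) v)"
      using Suc.prems(1) by simp
    show "frechet_derivative f (at x) v = frechet_derivative g (at x) v" if "x \<in> S" for x
      using frechet_derivative_transform_within_open[OF d[OF that] assms(1) that Suc.prems(2)] by simp
  qed
  ultimately show ?case by simp
qed

text \<open>\<open>frechet_derivative\<close> is a choice operator; this form lets an explicitly
  computed derivative \<open>D\<close> take its place, which is how the closure properties below are
  derived.\<close>

lemma n_times_C_on_SucI:
  assumes "open S" "\<And>x. x \<in> S \<Longrightarrow> (f has_derivative D x) (at x)"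
    and "\<And>v. n_times_C_on n S (\<lambda>x. D x v)"
  shows "n_times_C_on (Suc n) S f"
proof -
  have "n_times_C_on n S (\<lambda>x. frechet_derivative f (at x) v)" for v
    using assms(1) assms(3)[of v] by (rule n_times_C_on_cong) (metis assms(2) frechet_derivative_at)
  then show ?thesis
    using assms(2) by (auto simp: differentiable_def)
qed

lemma n_times_C_on_SucD:
  assumes "n_times_C_on (Suc n) S f" "x \<in> S"
  shows "(f has_derivative frechet_derivative f (at x)) (at x)"
  using assms frechet_derivative_works[of f "at x"] by simp

lemma n_times_C_on_subset:
  "n_times_C_on n S f \<Longrightarrow> T \<subseteq> S \<Longrightarrow> n_times_C_on n T f"
proof (induction n arbitrary: f)
  case 0
  then show ?case using continuous_on_subset by auto
next
  case (Suc n)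
  then show ?case by (auto simp: subset_iff)
qed

lemma n_times_C_on_local:
  "(\<And>x. x \<in> S \<Longrightarrow> \<exists>W. open W \<and> x \<in> W \<and> n_times_C_on n W f) \<Longrightarrow> n_times_C_on n S f"
proof (induction n arbitrary: f)
  case 0
  have "isCont f x" if "x \<in> S" for x
    using 0[OF that] by (auto simp: continuous_on_eq_continuous_at)
  then show ?case
    by (simp add: continuous_at_imp_continuous_on)
next
  case (Suc n)
  have "n_times_C_on n S (\<lambda>x. frechet_derivative f (at x) v)" for v
    using Suc.prems by (intro Suc.IH) fastforce
  moreover have "f differentiable at x" if "x \<in> S" for x
    using Suc.prems[OF that] by auto
  ultimately show ?case by simp
qed

lemma n_times_C_on_Suc_imp: "n_times_C_on (Suc n) S f \<Longrightarrow> n_times_C_on n S f"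
proof (induction n arbitrary: f)
  case 0
  then show ?case
    by (auto intro!: continuous_at_imp_continuous_on differentiable_imp_continuous_within)
next
  case (Suc n)
  then show ?case by auto
qed

lemma n_times_C_on_const: "open S \<Longrightarrow> n_times_C_on n S (\<lambda>x. c)"
proof (induction n arbitrary: c)
  case (Suc n)
  then show ?case
    by (intro n_times_C_on_SucI[where D = "\<lambda>x v. 0"]) auto
qed simp

lemma n_times_C_on_bounded_linear:
  assumes "bounded_linear h" "open S" shows "n_times_C_on n S h"
proof (cases n)
  case 0
  then show ?thesis
    using assms linear_continuous_on by auto
next
  case (Suc m)
  show ?thesis
    unfolding Suc
    by (rule n_times_C_on_SucI[OF assms(2) bounded_linear_imp_has_derivative[OF assms(1)]
          n_times_C_on_const[OF assms(2)]])
qed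

lemma n_times_C_on_bounded_linear_compose:
  assumes "bounded_linear h" "open S" "n_times_C_on n S f"
  shows "n_times_C_on n S (\<lambda>x. h (f x))"
  using assms(3)
proof (induction n arbitrary: f)
  case 0
  then show ?case
    using assms(1) bounded_linear.continuous_on by auto
next
  case (Suc n)
  show ?case
  proof (rule n_times_C_on_SucI[OF assms(2)])
    show "((\<lambda>x. h (f x)) has_derivative (\<lambda>v. h (frechet_derivative f (at x) v))) (at x)" if "x \<in> S" for x
      by (rule bounded_linear.has_derivative[OF assms(1) n_times_C_on_SucD[OF Suc.prems that]])
    show "n_times_C_on n S (\<lambda>x. h (frechet_derivative f (at x) v))" for v
      using Suc by auto
  qed
qed

lemma n_times_C_on_add:
  assumes "open S" "n_times_C_on n S f" "n_times_C_on n S g"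
  shows "n_times_C_on n S (\<lambda>x. f x + g x)"
  using assms(2,3)
proof (induction n arbitrary: f g)
  case 0
  then show ?case by (auto intro: continuous_on_add)
next
  case (Suc n)
  show ?case
  proof (rule n_times_C_on_SucI[OF assms(1)])
    show "((\<lambda>x. f x + g x) has_derivative
        (\<lambda>v. frechet_derivative f (at x) v + frechet_derivative g (at x) v)) (at x)" if "x \<in> S" for x
      by (rule has_derivative_add[OF n_times_C_on_SucD[OF Suc.prems(1) that] n_times_C_on_SucD[OF Suc.prems(2) that]])
  qed (use Suc in auto)
qed

lemma n_times_C_on_sum:
  assumes "open S" "\<And>i. i \<in> I \<Longrightarrow> n_times_C_on n S (f i)"
  shows "n_times_C_on n S (\<lambda>x. \<Sum>i\<in>I. f i x)"
  using assms(2)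
  by (induction I rule: infinite_finite_induct)
    (auto intro: n_times_C_on_add n_times_C_on_const assms(1))

lemma n_times_C_on_scaleR:
  assumes "open S" "n_times_C_on n S a" "n_times_C_on n S f"
  shows "n_times_C_on n S (\<lambda>x. a x *\<^sub>R f x)"
  using assms(2,3)
proof (induction n arbitrary: a f)
  case 0
  then show ?case by (auto intro: continuous_on_scaleR)
next
  case (Suc n)
  show ?case
  proof (rule n_times_C_on_SucI[OF assms(1)])
    show "((\<lambda>x. a x *\<^sub>R f x) has_derivative
        (\<lambda>v. a x *\<^sub>R frechet_derivative f (at x) v + frechet_derivative a (at x) v *\<^sub>R f x)) (at x)"
      if "x \<in> S" for x
      by (rule has_derivative_scaleR[OF n_times_C_on_SucD[OF Suc.prems(1) that] n_times_C_on_SucD[OF Suc.prems(2) that]])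
    show "n_times_C_on n S
        (\<lambda>x. a x *\<^sub>R frechet_derivative f (at x) v + frechet_derivative a (at x) v *\<^sub>R f x)" for v
      using Suc.prems n_times_C_on_Suc_imp[OF Suc.prems(1)] n_times_C_on_Suc_imp[OF Suc.prems(2)]
      by (intro n_times_C_on_add[OF assms(1)] Suc.IH) auto
  qed
qed

lemma n_times_C_on_mult:
  fixes f g :: "'a::euclidean_space \<Rightarrow> real"
  assumes "open S" "n_times_C_on n S f" "n_times_C_on n S g"
  shows "n_times_C_on n S (\<lambda>x. f x * g x)"
  using n_times_C_on_scaleR[OF assms] by simp

lemma n_times_C_on_prod:
  fixes f :: "'i \<Rightarrow> 'a::euclidean_space \<Rightarrow> real"
  assumes "open S" "\<And>i. i \<in> I \<Longrightarrow> n_times_C_on n S (f i)"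
  shows "n_times_C_on n S (\<lambda>x. \<Prod>i\<in>I. f i x)"
  using assms(2)
  by (induction I rule: infinite_finite_induct)
    (auto intro: n_times_C_on_mult n_times_C_on_const assms(1))

text \<open>In the chain rule the direction fed to the derivative of \<open>g\<close> varies with
  \<open>x\<close>. Expanding it in \<open>Basis\<close> leaves products of scalar functions with
  partial derivatives of \<open>g\<close> in fixed directions, and to these the induction
  hypothesis, which is general in \<open>g\<close>, applies.\<close>

lemma n_times_C_on_compose:
  fixes g :: "'b::euclidean_space \<Rightarrow> 'c::euclidean_space"
  assumes "open S" "n_times_C_on n S f" "n_times_C_on n T g" "f ` S \<subseteq> T"
  shows "n_times_C_on n S (\<lambda>x. g (f x))"
  using assms(2-3)
proof (induction n arbitrary: g)
  case 0
  then show ?case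
    using assms(4) by (auto intro: continuous_on_compose2)
next
  case (Suc n)
  have lin: "linear (frechet_derivative g (at (f x)))" if "x \<in> S" for x
    using n_times_C_on_SucD[OF Suc.prems(2)] assms(4) that has_derivative_linear by blast
  show ?case
  proof (rule n_times_C_on_SucI[OF assms(1)])
    show "((\<lambda>x. g (f x)) has_derivative
        (\<lambda>v. \<Sum>b\<in>Basis. (frechet_derivative f (at x) v \<bullet> b) *\<^sub>R frechet_derivative g (at (f x)) b)) (at x)"
      if x: "x \<in> S" for x
    proof -
      have "((\<lambda>x. g (f x)) has_derivative
          (\<lambda>v. frechet_derivative g (at (f x)) (frechet_derivative f (at x) v))) (at x)"
        by (rule has_derivative_compose[OF n_times_C_on_SucD[OF Suc.prems(1) x] n_times_C_on_SucD[OF Suc.prems(2)]])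
          (use assms(4) x in auto)
      also have "(\<lambda>v. frechet_derivative g (at (f x)) (frechet_derivative f (at x) v)) =
        (\<lambda>v. \<Sum>b\<in>Basis. (frechet_derivative f (at x) v \<bullet> b) *\<^sub>R frechet_derivative g (at (f x)) b)"
        (is "?l = ?r")
      proof
        fix v
        have "?l v = frechet_derivative g (at (f x))
            (\<Sum>b\<in>Basis. (frechet_derivative f (at x) v \<bullet> b) *\<^sub>R b)"
          by (simp add: euclidean_representation)
        also have "\<dots> = ?r v"
          by (simp add: linear_sum[OF lin[OF x]] linear_scale[OF lin[OF x]])
        finally show "?l v = ?r v" .
      qed
      finally show ?thesis .
    qed
    have f: "n_times_C_on n S f"
      by (rule n_times_C_on_Suc_imp[OF Suc.prems(1)])
    show "n_times_C_on n S (\<lambda>x. \<Sum>b\<in>Basis.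
        (frechet_derivative f (at x) v \<bullet> b) *\<^sub>R frechet_derivative g (at (f x)) b)" for v
      using Suc.prems
      by (intro n_times_C_on_sum n_times_C_on_scaleR assms(1) Suc.IH[OF f]
          n_times_C_on_bounded_linear_compose[OF bounded_linear_inner_left]) auto
  qed
qed

section \<open>Reciprocals, determinants and inverse maps\<close>

lemma n_times_C_on_inverse:
  fixes h :: "'a::euclidean_space \<Rightarrow> real"
  assumes "open S" "n_times_C_on n S h" "\<And>x. x \<in> S \<Longrightarrow> h x \<noteq> 0"
  shows "n_times_C_on n S (\<lambda>x. inverse (h x))"
  using assms(2)
proof (induction n)
  case 0
  then show ?case by (auto intro!: continuous_on_inverse assms(3))
next
  case (Suc n)
  show ?case
  proof (rule n_times_C_on_SucI[OF assms(1)])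
    show "((\<lambda>x. inverse (h x)) has_derivative
        (\<lambda>v. (- 1) * (inverse (h x) * frechet_derivative h (at x) v * inverse (h x)))) (at x)"
      if "x \<in> S" for x
      using Deriv.has_derivative_inverse[OF assms(3)[OF that] n_times_C_on_SucD[OF Suc.prems that]] by simp
    show "n_times_C_on n S (\<lambda>x. (- 1) * (inverse (h x) * frechet_derivative h (at x) v * inverse (h x)))" for v
      using Suc n_times_C_on_Suc_imp[OF Suc.prems]
      by (intro n_times_C_on_mult n_times_C_on_const assms(1)) auto
  qed
qed

lemma n_times_C_on_det:
  fixes A :: "'a::euclidean_space \<Rightarrow> real^'k^'k"
  assumes "open S" "\<And>i j. n_times_C_on n S (\<lambda>x. A x $ i $ j)"
  shows "n_times_C_on n S (\<lambda>x. det (A x))"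
  unfolding det_def
  by (intro n_times_C_on_sum n_times_C_on_mult n_times_C_on_prod n_times_C_on_const assms)

lemma n_times_C_on_vec:
  fixes f :: "'a::euclidean_space \<Rightarrow> real^'k"
  assumes "open S" "\<And>i. n_times_C_on n S (\<lambda>x. f x $ i)"
  shows "n_times_C_on n S f"
proof -
  have "n_times_C_on n S (\<lambda>x. \<Sum>i\<in>UNIV. f x $ i *\<^sub>R axis i (1::real))"
    by (intro n_times_C_on_sum n_times_C_on_scaleR n_times_C_on_const assms)
  moreover have "(\<Sum>i\<in>UNIV. f x $ i *\<^sub>R axis i (1::real)) = f x" for x
    using basis_expansion[of "f x"] by (simp add: scalar_mult_eq_scaleR)
  ultimately show ?thesis by simp
qed

text \<open>Cramer's rule turns the derivative of the inverse map into a rational expression in the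
  partial derivatives of \<open>F\<close> at \<open>G y\<close>, so each order of smoothness of \<open>G\<close> yields the next.\<close>

lemma n_times_C_on_inverse_map:
  fixes F G :: "real^'k \<Rightarrow> real^'k"
  assumes "open U" "open V" "G ` V \<subseteq> U" "continuous_on V G"
    and inv: "\<And>y. y \<in> V \<Longrightarrow> F (G y) = y"
    and bij: "\<And>y. y \<in> V \<Longrightarrow> bij (frechet_derivative F (at (G y)))"
    and der: "\<And>y. y \<in> V \<Longrightarrow> (G has_derivative G' y) (at y)"
    and "n_times_C_on n U F"
  shows "n_times_C_on n V G"
  using assms(8)
proof (induction n)
  case 0
  then show ?case using assms(4) by simp
next
  case (Suc n)
  define DF where "DF y = frechet_derivative F (at (G y))" for y
  define A where "A y = matrix (DF y)" for y
  have dF: "(F has_derivative DF y) (at (G y))" if "y \<in> V" for y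
    unfolding DF_def using n_times_C_on_SucD[OF Suc.prems] assms(3) that by blast
  have lin: "linear (DF y)" if "y \<in> V" for y
    using dF[OF that] has_derivative_linear by blast
  have A: "A y *v v = DF y v" if "y \<in> V" for y v
    unfolding A_def using lin[OF that] by (simp add: matrix_works)
  \<comment> \<open>Differentiating \<open>F (G y) = y\<close> gives the linear system that Cramer's
    rule solves for \<open>G' y v\<close>.\<close>
  have G': "DF y (G' y v) = v" if y: "y \<in> V" for y v
  proof -
    have "((\<lambda>y. F (G y)) has_derivative (\<lambda>v. DF y (G' y v))) (at y)"
      by (rule has_derivative_compose[OF der[OF y] dF[OF y]])
    moreover have "((\<lambda>y. F (G y)) has_derivative (\<lambda>v. v)) (at y)"
      by (rule has_derivative_transform_within_open[OF has_derivative_ident assms(2) y]) (simp add: inv)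
    ultimately show ?thesis
      using has_derivative_unique by metis
  qed
  have det: "det (A y) \<noteq> 0" if "y \<in> V" for y
    using bij[OF that] lin[OF that] unfolding A_def DF_def
    by (simp add: det_nz_iff_inj bij_is_inj matrix_of_matrix_vector_mul)
  have cram: "G' y v $ i = det (\<chi> a b. if b = i then v $ a else A y $ a $ b) * inverse (det (A y))"
    if "y \<in> V" for y v i
  proof -
    have "A y *v G' y v = v"
      using A G' that by simp
    then show ?thesis
      using cramer[OF det[OF that], of "G' y v" v] by (simp add: divide_inverse vec_eq_iff)
  qed
  have nG: "n_times_C_on n V G"
    by (rule Suc.IH[OF n_times_C_on_Suc_imp[OF Suc.prems]])
  have nA: "n_times_C_on n V (\<lambda>y. A y $ a $ b)" for a b
  proof -
    have "n_times_C_on n V (\<lambda>y. frechet_derivative F (at (G y)) (axis b 1))"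
      using Suc.prems by (intro n_times_C_on_compose[OF assms(2) nG _ assms(3),
            where g = "\<lambda>x. frechet_derivative F (at x) (axis b 1)"]) auto
    then show ?thesis
      unfolding A_def matrix_def DF_def
      using n_times_C_on_bounded_linear_compose[OF bounded_linear_vec_nth assms(2)] by simp
  qed
  show ?case
  proof (rule n_times_C_on_SucI[OF assms(2) der])
    show "n_times_C_on n V (\<lambda>y. G' y v)" for v
    proof (rule n_times_C_on_vec[OF assms(2)])
      fix i
      have "n_times_C_on n V (\<lambda>y. if b = i then v $ a else A y $ a $ b)" for a b
        using nA n_times_C_on_const[OF assms(2)] by (cases "b = i") auto
      then have "n_times_C_on n V
          (\<lambda>y. det (\<chi> a b. if b = i then v $ a else A y $ a $ b) * inverse (det (A y)))"
        by (intro n_times_C_on_mult n_times_C_on_inverse n_times_C_on_det assms(2) nA det) auto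
      then show "n_times_C_on n V (\<lambda>y. G' y v $ i)"
        by (rule n_times_C_on_cong[OF assms(2)]) (simp add: cram)
    qed
  qed
qed

section \<open>Random linear perturbations\<close>

text \<open>The norm of the type of matrices is the Euclidean (Frobenius) norm, so Cauchy-Schwarz is
  applied to each row.\<close>

lemma norm_matrix_vector_mult_le:
  fixes L :: "real^'n^'k"
  shows "norm (L *v u) \<le> norm L * norm u"
proof -
  have "norm (L *v u) \<le> L2_set (\<lambda>i. norm (L $ i) * norm u) UNIV"
    unfolding norm_vec_def[of "L *v u"]
    by (intro L2_set_mono) (auto simp: matrix_mult_dot Cauchy_Schwarz_ineq2)
  also have "\<dots> = norm L * norm u"
    by (simp add: norm_vec_def[of L] L2_set_left_distrib)
  finally show ?thesis .
qed

lemma continuous_on_matrix_vector_mult [continuous_intros]: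
  fixes f :: "'a::topological_space \<Rightarrow> real^'n^'k"
  assumes "continuous_on S f" "continuous_on S g"
  shows "continuous_on S (\<lambda>x. f x *v g x)"
  unfolding matrix_vector_mult_def
  by (intro continuous_on_vec_lambda continuous_intros assms)

lemma compact_slab:
  fixes v :: "real^'n" and w :: "real^'k"
  shows "compact {L \<in> cball 0 R. norm (L *v v + w) \<le> \<epsilon>}"
proof -
  have "closed {L :: real^'n^'k. norm (L *v v + w) \<le> \<epsilon>}"
    by (intro closed_Collect_le continuous_intros)
  then have "compact (cball 0 R \<inter> {L :: real^'n^'k. norm (L *v v + w) \<le> \<epsilon>})"
    by (intro compact_Int_closed compact_cball)
  moreover have "cball 0 R \<inter> {L :: real^'n^'k. norm (L *v v + w) \<le> \<epsilon>}
      = {L \<in> cball 0 R. norm (L *v v + w) \<le> \<epsilon>}" by blast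
  ultimately show ?thesis by simp
qed

text \<open>A packing argument. Adding \<open>z p\<close> to \<open>L\<close> shifts
  \<open>L *v v\<close> by the grid vector with entries 3 \<epsilon> \<open>p i\<close>. The
  \<open>n ^ CARD('k)\<close> translates of the slab are disjoint and fit into one larger ball, so
  the slab has at most the fraction \<open>1 / n ^ CARD('k)\<close> of its volume, and
  \<open>1 / n\<close> is at most 3 \<epsilon> / |v|.\<close>

lemma measure_slab_le_pos:
  fixes v :: "real^'n" and w :: "real^'k"
  assumes "v \<noteq> 0" "0 < \<epsilon>" "0 \<le> R"
  shows "measure lebesgue {L \<in> cball 0 R. norm (L *v v + w) \<le> \<epsilon>}
    \<le> measure lebesgue (cball (0 :: real^'n^'k) (R + CARD('k))) * (3 * \<epsilon> / norm v) ^ CARD('k)"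
proof -
  define S where "S = {L :: real^'n^'k. L \<in> cball 0 R \<and> norm (L *v v + w) \<le> \<epsilon>}"
  \<comment> \<open>Large enough for 1 / n \<le> 3 \<epsilon> / |v|, yet small enough that grid
    indices up to \<open>n - 1\<close> keep each row of \<open>z p\<close> within norm 1; summing
    the rows gives the radius increment \<open>CARD('k)\<close>.\<close>
  define n where "n = nat \<lfloor>norm v / (3 * \<epsilon>)\<rfloor> + 1"
  define z :: "('k \<Rightarrow> nat) \<Rightarrow> real^'n^'k"
    where "z p = (\<chi> i. (3 * \<epsilon> * p i / (norm v)^2) *\<^sub>R v)" for p
  define P where "P = PiE (UNIV :: 'k set) (\<lambda>_. {..<n})"
  have n: "norm v / (3 * \<epsilon>) \<le> n" "real (n - 1) \<le> norm v / (3 * \<epsilon>)"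
  proof -
    have "0 \<le> norm v / (3 * \<epsilon>)" using assms by simp
    then show "norm v / (3 * \<epsilon>) \<le> n" "real (n - 1) \<le> norm v / (3 * \<epsilon>)"
      unfolding n_def by (simp_all add: of_nat_nat) linarith
  qed
  have P: "finite P" "card P = n ^ CARD('k)"
    unfolding P_def by (simp_all add: finite_PiE card_PiE)
  have zv: "(z p *v v) $ i = 3 * \<epsilon> * p i" for p i
    using assms by (simp add: matrix_mult_dot z_def power2_norm_eq_inner)
  have nz: "norm (z p) \<le> CARD('k)" if "p \<in> P" for p
  proof -
    have "norm (z p $ i) \<le> 1" for i
    proof -
      have "p i < n"
        using that unfolding P_def by (auto simp: PiE_def Pi_def)
      then have "real (p i) \<le> real (n - 1)"
        by simp
      then have "real (p i) \<le> norm v / (3 * \<epsilon>)"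
        using n by linarith
      then have "3 * \<epsilon> * p i \<le> norm v"
        using assms by (simp add: field_simps)
      moreover have "norm (z p $ i) = 3 * \<epsilon> * p i / norm v"
        using assms by (simp add: z_def power2_eq_square)
      ultimately show ?thesis
        using assms by (simp add: pos_divide_le_eq del: divide_le_eq_1)
    qed
    then have "(\<Sum>i\<in>UNIV. norm (z p $ i)) \<le> (\<Sum>i\<in>(UNIV::'k set). 1)"
      by (intro sum_mono)
    moreover have "norm (z p) \<le> (\<Sum>i\<in>UNIV. norm (z p $ i))"
      unfolding norm_vec_def[of "z p"] by (rule L2_set_le_sum) simp
    ultimately show ?thesis by simp
  qed
  have S: "S \<in> lmeasurable"
    unfolding S_def using compact_slab by (rule lmeasurable_compact)
  \<comment> \<open>A common point would put two grid vectors within 2 \<epsilon> of each other,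
    which is less than the grid spacing 3 \<epsilon>, so their integer indices agree.\<close>
  have disj: "disjoint_family_on (\<lambda>p. (+) (z p) ` S) P"
    unfolding disjoint_family_on_def
  proof (intro ballI impI, rule ccontr)
    fix p q assume "p \<in> P" "q \<in> P" "p \<noteq> q" "(+) (z p) ` S \<inter> (+) (z q) ` S \<noteq> {}"
    then obtain L L' where L: "L \<in> S" "L' \<in> S" "z p + L = z q + L'" by blast
    have "p i = q i" for i
    proof -
      have "(z p + L) *v v = (z q + L') *v v" using L by simp
      then have "z p *v v - z q *v v = (L' *v v + w) - (L *v v + w)"
        by (simp add: matrix_vector_mult_add_rdistrib algebra_simps)
      then have "norm (z p *v v - z q *v v) \<le> norm (L' *v v + w) + norm (L *v v + w)"
        by (metis norm_triangle_ineq4)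
      also have "\<dots> \<le> 2 * \<epsilon>" using L by (simp add: S_def)
      finally have "\<bar>(z p *v v - z q *v v) $ i\<bar> \<le> 2 * \<epsilon>"
        using component_le_norm_cart order_trans by blast
      then have "\<bar>3 * \<epsilon> * p i - 3 * \<epsilon> * q i\<bar> \<le> 2 * \<epsilon>"
        by (simp add: zv)
      then have "\<epsilon> * (3 * \<bar>real (p i) - q i\<bar>) \<le> \<epsilon> * 2"
        using assms by (simp add: abs_mult flip: right_diff_distrib)
      then have "3 * \<bar>real (p i) - q i\<bar> \<le> 2"
        using assms by simp
      then have "\<bar>real (p i) - q i\<bar> < 1" by simp
      then have "\<not> real (p i) + 1 \<le> q i" "\<not> real (q i) + 1 \<le> p i"
        unfolding abs_less_iff by simp_all
      then show ?thesis
        using nat_less_real_le by (metis linorder_neqE_nat)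
    qed
    with \<open>p \<noteq> q\<close> show False by auto
  qed
  have m: "(+) (z p) ` S \<in> lmeasurable" for p
    using S by (rule measurable_translation)
  have "real (card P) * measure lebesgue S = (\<Sum>p\<in>P. measure lebesgue ((+) (z p) ` S))"
    by (simp add: measure_translation)
  also have "\<dots> = measure lebesgue (\<Union>p\<in>P. (+) (z p) ` S)"
    using P(1) fmeasurableD[OF m] disj fmeasurableD2[OF m]
    by (intro measure_finite_Union[symmetric]) auto
  also have "\<dots> \<le> measure lebesgue (cball (0 :: real^'n^'k) (R + CARD('k)))"
  proof (rule measure_mono_fmeasurable)
    show "(\<Union>p\<in>P. (+) (z p) ` S) \<subseteq> cball 0 (R + CARD('k))"
    proof safe
      fix p L assume "p \<in> P" "L \<in> S"
      then show "z p + L \<in> cball 0 (R + CARD('k))"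
        using nz[of p] norm_triangle_ineq[of "z p" L] by (simp add: S_def)
    qed
    show "(\<Union>p\<in>P. (+) (z p) ` S) \<in> sets lebesgue"
      using m P by (intro sets.finite_UN) auto
  qed simp
  finally have *: "n ^ CARD('k) * measure lebesgue S
      \<le> measure lebesgue (cball (0 :: real^'n^'k) (R + CARD('k)))"
    by (simp add: P)
  have "1 \<le> n * (3 * \<epsilon> / norm v)"
    using n(1) assms by (simp add: field_simps)
  then have "1 \<le> (n * (3 * \<epsilon> / norm v)) ^ CARD('k)"
    by (rule one_le_power)
  then have "measure lebesgue S * 1 \<le> measure lebesgue S * (n * (3 * \<epsilon> / norm v)) ^ CARD('k)"
    by (rule mult_left_mono) simp
  also have "\<dots> = (n ^ CARD('k) * measure lebesgue S) * (3 * \<epsilon> / norm v) ^ CARD('k)"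
    unfolding power_mult_distrib by simp
  also have "\<dots> \<le> measure lebesgue (cball (0 :: real^'n^'k) (R + CARD('k))) * (3 * \<epsilon> / norm v) ^ CARD('k)"
    using * assms by (intro mult_right_mono) auto
  finally show ?thesis by (simp add: S_def)
qed

text \<open>The width 0 occurs when a covering set has diameter 0. It is reached by letting widths
  \<eta> > \<epsilon> decrease to \<epsilon>.\<close>

lemma measure_slab_le:
  fixes v :: "real^'n" and w :: "real^'k"
  assumes "v \<noteq> 0" "0 \<le> \<epsilon>" "0 \<le> R"
  shows "measure lebesgue {L \<in> cball 0 R. norm (L *v v + w) \<le> \<epsilon>}
    \<le> measure lebesgue (cball (0 :: real^'n^'k) (R + CARD('k))) * (3 * \<epsilon> / norm v) ^ CARD('k)"
proof (rule tendsto_lowerbound)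
  let ?K = "measure lebesgue (cball (0 :: real^'n^'k) (R + CARD('k)))"
  show "((\<lambda>\<eta>. ?K * (3 * \<eta> / norm v) ^ CARD('k)) \<longlongrightarrow> ?K * (3 * \<epsilon> / norm v) ^ CARD('k)) (at_right \<epsilon>)"
    using assms by (intro tendsto_intros) auto
  show "\<forall>\<^sub>F \<eta> in at_right \<epsilon>. measure lebesgue {L \<in> cball 0 R. norm (L *v v + w) \<le> \<epsilon>}
      \<le> ?K * (3 * \<eta> / norm v) ^ CARD('k)"
    unfolding eventually_at_filter
  proof (rule always_eventually, intro allI impI)
    fix \<eta> assume "\<eta> \<noteq> \<epsilon>" "\<eta> \<in> {\<epsilon><..}"
    then have "\<epsilon> < \<eta>" by simp
    have "measure lebesgue {L \<in> cball 0 R. norm (L *v v + w) \<le> \<epsilon>}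
        \<le> measure lebesgue {L \<in> cball 0 R. norm (L *v v + w) \<le> \<eta>}"
      using \<open>\<epsilon> < \<eta>\<close> compact_slab[where 'n='n and 'k='k]
      by (intro measure_mono_fmeasurable lmeasurable_compact fmeasurableD) auto
    also have "\<dots> \<le> ?K * (3 * \<eta> / norm v) ^ CARD('k)"
      using assms \<open>\<epsilon> < \<eta>\<close> by (intro measure_slab_le_pos) auto
    finally show "measure lebesgue {L \<in> cball 0 R. norm (L *v v + w) \<le> \<epsilon>}
      \<le> ?K * (3 * \<eta> / norm v) ^ CARD('k)" .
  qed
qed simp

section \<open>Sets of vanishing Hausdorff measure\<close>

text \<open>The mesh bound is dropped: for \<open>k > 0\<close> a small sum of \<open>k\<close>-th
  powers already forces every diameter to be small. Real sums with explicit summability replace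
  \<open>ennreal\<close> sums, so that constants can be moved in and out.\<close>

definition hausdorff_null :: "nat \<Rightarrow> 'a::metric_space set \<Rightarrow> bool" where
  "hausdorff_null k Y \<longleftrightarrow> (\<forall>e>0. \<exists>C :: nat \<Rightarrow> 'a set. Y \<subseteq> (\<Union>i. C i) \<and> (\<forall>i. bounded (C i)) \<and>
     summable (\<lambda>i. diameter (C i) ^ k) \<and> (\<Sum>i. diameter (C i) ^ k) \<le> e)"

lemma hausdorff_null_subset: "hausdorff_null k Y \<Longrightarrow> Z \<subseteq> Y \<Longrightarrow> hausdorff_null k Z"
  unfolding hausdorff_null_def by (meson order_trans)

text \<open>The pre-measure at the single scale 1 lies below the supremum, so it vanishes and yields
  the covers. Since \<open>0 < k\<close>, the separate value for the empty set agrees with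
  \<open>diameter {} ^ k = 0\<close>.\<close>

lemma hausdorff_null_if_measure_0:
  assumes "hausdorff_measure k Y = 0" "0 < k"
  shows "hausdorff_null k Y"
  unfolding hausdorff_null_def
proof (intro allI impI)
  fix e :: real assume "0 < e"
  have "hausdorff_pre_measure k 1 Y \<le> hausdorff_measure k Y"
    unfolding hausdorff_measure_def by (rule SUP_upper) simp
  then have "hausdorff_pre_measure k 1 Y < ennreal e"
    using assms \<open>0 < e\<close> by simp
  then obtain C :: "nat \<Rightarrow> 'a set" where C: "Y \<subseteq> (\<Union>i. C i)" "\<And>i. bounded (C i)"
    and sum: "(\<Sum>i. if C i = {} then 0 else ennreal (diameter (C i) ^ k)) < ennreal e"
    unfolding hausdorff_pre_measure_def by (auto simp: INF_less_iff)
  have "(if C i = {} then 0 else ennreal (diameter (C i) ^ k)) = ennreal (diameter (C i) ^ k)" for i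
    using assms(2) by simp
  with sum have sum': "(\<Sum>i. ennreal (diameter (C i) ^ k)) < ennreal e"
    by (simp only:)
  have pos: "0 \<le> diameter (C i) ^ k" for i
    by (intro zero_le_power diameter_ge_0 C(2))
  have s: "summable (\<lambda>i. diameter (C i) ^ k)"
    using sum' by (intro summable_suminf_not_top pos) auto
  then have "(\<Sum>i. ennreal (diameter (C i) ^ k)) = ennreal (\<Sum>i. diameter (C i) ^ k)"
    by (intro suminf_ennreal2 pos)
  with sum' have "(\<Sum>i. diameter (C i) ^ k) \<le> e"
    using \<open>0 < e\<close> by (simp add: ennreal_less_iff suminf_nonneg pos s)
  with C s show "\<exists>C :: nat \<Rightarrow> 'a set. Y \<subseteq> (\<Union>i. C i) \<and> (\<forall>i. bounded (C i)) \<and>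
     summable (\<lambda>i. diameter (C i) ^ k) \<and> (\<Sum>i. diameter (C i) ^ k) \<le> e" by blast
qed

lemma hausdorff_null_Lipschitz_image:
  fixes f :: "'a::euclidean_space \<Rightarrow> 'b::euclidean_space"
  assumes "hausdorff_null k Y" and "0 \<le> K"
    and lip: "\<And>x y. x \<in> Y \<Longrightarrow> y \<in> Y \<Longrightarrow> norm (f x - f y) \<le> K * norm (x - y)"
  shows "hausdorff_null k (f ` Y)"
  unfolding hausdorff_null_def
proof (intro allI impI)
  fix e :: real assume "0 < e"
  \<comment> \<open>The \<open>+ 1\<close> keeps the denominator positive when
    \<open>K = 0\<close>.\<close>
  then have "0 < e / (K ^ k + 1)"
    using assms(2) by (simp add: add_nonneg_pos)
  then obtain C :: "nat \<Rightarrow> 'a set" where C: "Y \<subseteq> (\<Union>i. C i)" "\<And>i. bounded (C i)"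
    "summable (\<lambda>i. diameter (C i) ^ k)" "(\<Sum>i. diameter (C i) ^ k) \<le> e / (K ^ k + 1)"
    using assms(1) unfolding hausdorff_null_def by blast
  \<comment> \<open>The covering sets may leave \<open>Y\<close>, where nothing is known about
    \<open>f\<close>; hence the intersection.\<close>
  define D where "D i = f ` (C i \<inter> Y)" for i
  have diam: "diameter (C i) \<ge> 0" for i
    using C(2) diameter_ge_0 by blast
  have n: "norm (u - v) \<le> K * diameter (C i)" if uv: "u \<in> D i" "v \<in> D i" for u v i
  proof -
    obtain x y where xy: "x \<in> C i" "y \<in> C i" "x \<in> Y" "y \<in> Y" "u = f x" "v = f y"
      using uv unfolding D_def by blast
    then have "norm (u - v) \<le> K * norm (x - y)" using lip by simp
    also have "\<dots> \<le> K * diameter (C i)"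
      using diameter_bounded_bound[OF C(2), of x i y] xy assms(2) by (simp add: dist_norm mult_left_mono)
    finally show ?thesis .
  qed
  have "bounded (D i)" for i
    using n[of _ i] by (metis boundedI bounded_any_center bounded_def dist_norm)
  have dD: "diameter (D i) ^ k \<le> K ^ k * diameter (C i) ^ k" for i
  proof -
    have "diameter (D i) \<le> K * diameter (C i)"
      using n diam assms(2) by (intro diameter_le) auto
    then have "diameter (D i) ^ k \<le> (K * diameter (C i)) ^ k"
      using diameter_ge_0[OF \<open>bounded (D i)\<close>] by (intro power_mono)
    then show ?thesis by (simp add: power_mult_distrib)
  qed
  have s: "summable (\<lambda>i. K ^ k * diameter (C i) ^ k)"
    using C(3) by (rule summable_mult)
  have s': "summable (\<lambda>i. diameter (D i) ^ k)"
    using dD diameter_ge_0[OF \<open>bounded (D _)\<close>] by (intro summable_comparison_test'[OF s]) auto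
  have "(\<Sum>i. diameter (D i) ^ k) \<le> (\<Sum>i. K ^ k * diameter (C i) ^ k)"
    using dD s s' by (intro suminf_le) auto
  also have "\<dots> = K ^ k * (\<Sum>i. diameter (C i) ^ k)"
    using C(3) by (rule suminf_mult)
  also have "\<dots> \<le> K ^ k * (e / (K ^ k + 1))"
    using C(4) assms(2) by (intro mult_left_mono) auto
  also have "\<dots> \<le> e"
  proof -
    have "0 \<le> K ^ k" using assms(2) by simp
    then show ?thesis
      using \<open>0 < e\<close> by (simp add: pos_divide_le_eq algebra_simps)
  qed
  finally have "(\<Sum>i. diameter (D i) ^ k) \<le> e" .
  moreover have "f ` Y \<subseteq> (\<Union>i. D i)"
    using C(1) unfolding D_def by blast
  ultimately show "\<exists>C :: nat \<Rightarrow> 'b set. f ` Y \<subseteq> (\<Union>i. C i) \<and> (\<forall>i. bounded (C i)) \<and>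
     summable (\<lambda>i. diameter (C i) ^ k) \<and> (\<Sum>i. diameter (C i) ^ k) \<le> e"
    using \<open>\<And>i. bounded (D i)\<close> s' by blast
qed

text \<open>The family is enumerated and padded with empty sets, which contribute
  \<open>0 ^ k\<close>, and this is 0 because \<open>0 < k\<close>. The index type is left free so
  that grid cells can be indexed by functions.\<close>

lemma hausdorff_null_finite_coverI:
  assumes "0 < k"
    and cov: "\<And>e. 0 < e \<Longrightarrow> \<exists>F f. finite (F :: 'i set) \<and> Y \<subseteq> (\<Union>i\<in>F. f i) \<and>
      (\<forall>i\<in>F. bounded (f i)) \<and> (\<Sum>i\<in>F. diameter (f i) ^ k) \<le> e"
  shows "hausdorff_null k (Y :: 'a::metric_space set)"
  unfolding hausdorff_null_def
proof (intro allI impI)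
  fix e :: real assume "0 < e"
  from cov[OF this] obtain F and f :: "'i \<Rightarrow> 'a set" where F: "finite F" "Y \<subseteq> (\<Union>i\<in>F. f i)"
      "\<And>i. i \<in> F \<Longrightarrow> bounded (f i)" "(\<Sum>i\<in>F. diameter (f i) ^ k) \<le> e" by blast
  obtain h where h: "bij_betw h {0..<card F} F"
    using ex_bij_betw_nat_finite[OF F(1)] by blast
  define C where "C j = (if j < card F then f (h j) else {})" for j
  have "Y \<subseteq> (\<Union>j. C j)"
  proof
    fix y assume "y \<in> Y"
    then obtain i where i: "i \<in> F" "y \<in> f i" using F(2) by blast
    then obtain j where "j < card F" "h j = i"
      using h by (metis atLeastLessThan_iff bij_betw_iff_bijections)
    then show "y \<in> (\<Union>j. C j)" using i by (auto simp: C_def)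
  qed
  moreover have "bounded (C j)" for j
    using F(3) bij_betwE[OF h] by (simp add: C_def)
  moreover have z: "diameter (C j) ^ k = 0" if "j \<notin> {0..<card F}" for j
    using that assms(1) by (simp add: C_def)
  moreover have "(\<Sum>j. diameter (C j) ^ k) = (\<Sum>j\<in>{0..<card F}. diameter (C j) ^ k)"
    using z by (intro suminf_finite) auto
  moreover have "\<dots> = (\<Sum>j\<in>{0..<card F}. diameter (f (h j)) ^ k)"
    by (rule sum.cong) (auto simp: C_def)
  moreover have "\<dots> = (\<Sum>i\<in>F. diameter (f i) ^ k)"
    by (rule sum.reindex_bij_betw[OF h])
  moreover have "summable (\<lambda>j. diameter (C j) ^ k)"
    by (rule summable_finite[of "{0..<card F}"]) (use z in auto)
  ultimately show "\<exists>C :: nat \<Rightarrow> 'a set. Y \<subseteq> (\<Union>i. C i) \<and> (\<forall>i. bounded (C i)) \<and>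
     summable (\<lambda>i. diameter (C i) ^ k) \<and> (\<Sum>i. diameter (C i) ^ k) \<le> e"
    using F(4) by (intro exI[of _ C]) auto
qed

text \<open>A grid in orthonormal coordinates cuts \<open>Y\<close> into
  \<open>(2 * n + 1) ^ d\<close> cells of diameter at most d \<rho> / n, where
  \<open>d = dim T\<close>. The sum of the \<open>k\<close>-th powers has order
  \<open>n ^ d / n ^ k\<close>, hence at most order \<open>1 / n\<close> because
  \<open>d + 1\<close> \<le> \<open>k\<close>.\<close>

lemma hausdorff_null_bounded_subspace:
  fixes T :: "'a::euclidean_space set"
  assumes "subspace T" "dim T < k" "bounded Y" "Y \<subseteq> T"
  shows "hausdorff_null k Y"
proof (rule hausdorff_null_finite_coverI)
  show "0 < k" using assms by simp
  obtain B where B: "B \<subseteq> T" "pairwise orthogonal B" "\<And>x. x \<in> B \<Longrightarrow> norm x = 1"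
      "independent B" "card B = dim T" "span B = T"
    using orthonormal_basis_subspace[OF assms(1)] by metis
  have finB: "finite B"
    using B(4) independent_imp_finite by blast
  obtain \<rho> where \<rho>: "0 < \<rho>" "\<And>y. y \<in> Y \<Longrightarrow> norm y \<le> \<rho>"
    using assms(3) bounded_pos by metis
  define d where "d = dim T"
  fix e :: real assume "0 < e"
  \<comment> \<open>The factor \<open>3 ^ d\<close> comes from 2 n + 1 \<le> 3 n, the rest from the
    \<open>k\<close>-th power of the cell diameter.\<close>
  define c where "c = 3 ^ d * (d * \<rho>) ^ k"
  obtain n :: nat where n: "c / e < n" "1 \<le> n"
  proof -
    obtain n0 :: nat where "c / e < n0" using reals_Archimedean2 by blast
    then show ?thesis by (intro that[of "n0 + 1"]) auto
  qed
  \<comment> \<open>Coordinates of points of \<open>Y\<close> have absolute value at most \<rho>, so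
    the floors defining the cells lie between \<open>- n\<close> and \<open>n\<close>, both ends
    included.\<close>
  define F where "F = PiE B (\<lambda>_. {- int n .. int n})"
  define cell where "cell p = {y \<in> Y. \<forall>b\<in>B. \<lfloor>n * (y \<bullet> b) / \<rho>\<rfloor> = p b}" for p :: "'a \<Rightarrow> int"
  have F: "finite F" "card F = (2 * n + 1) ^ d"
    using finB B(5) by (simp_all add: F_def finite_PiE card_PiE d_def)
      (simp add: nat_add_distrib nat_mult_distrib flip: of_nat_Suc)
  have "Y \<subseteq> (\<Union>p\<in>F. cell p)"
  proof
    fix y assume y: "y \<in> Y"
    define p where "p = (\<lambda>b\<in>B. \<lfloor>n * (y \<bullet> b) / \<rho>\<rfloor>)"
    have "\<lfloor>n * (y \<bullet> b) / \<rho>\<rfloor> \<in> {- int n .. int n}" if "b \<in> B" for b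
    proof -
      have "\<bar>y \<bullet> b\<bar> \<le> \<rho>"
        using Cauchy_Schwarz_ineq2[of y b] B(3)[OF that] \<rho>(2)[OF y] by simp
      then have "\<bar>(y \<bullet> b) / \<rho>\<bar> \<le> 1" using \<rho>(1) by simp
      then have "real n * \<bar>(y \<bullet> b) / \<rho>\<bar> \<le> real n * 1" by (intro mult_left_mono) auto
      then have "\<bar>n * (y \<bullet> b) / \<rho>\<bar> \<le> n" by (simp add: abs_mult)
      then have "n * (y \<bullet> b) / \<rho> \<le> n" "- real n \<le> n * (y \<bullet> b) / \<rho>"
        unfolding abs_le_iff by simp_all
      then show ?thesis
        by (auto simp: floor_le_iff le_floor_iff)
    qed
    then have "p \<in> F" by (auto simp: F_def p_def)
    moreover have "y \<in> cell p" using y by (simp add: cell_def p_def)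
    ultimately show "y \<in> (\<Union>p\<in>F. cell p)" by blast
  qed
  moreover have bd: "bounded (cell p)" for p
    using assms(3) bounded_subset by (auto simp: cell_def intro: bounded_subset)
  moreover have "(\<Sum>p\<in>F. diameter (cell p) ^ k) \<le> e"
  proof -
    have "diameter (cell p) \<le> d * \<rho> / n" for p
    proof (rule diameter_le)
      show "cell p \<noteq> {} \<or> 0 \<le> d * \<rho> / n" using \<rho>(1) by simp
      fix x y assume xy: "x \<in> cell p" "y \<in> cell p"
      have "\<bar>(x - y) \<bullet> b\<bar> \<le> \<rho> / n" if "b \<in> B" for b
      proof -
        have "\<lfloor>n * (x \<bullet> b) / \<rho>\<rfloor> = \<lfloor>n * (y \<bullet> b) / \<rho>\<rfloor>"
          using xy that by (simp add: cell_def)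
        then have "\<bar>n * (x \<bullet> b) / \<rho> - n * (y \<bullet> b) / \<rho>\<bar> \<le> 1"
          by linarith
        also have "n * (x \<bullet> b) / \<rho> - n * (y \<bullet> b) / \<rho> = n / \<rho> * ((x - y) \<bullet> b)"
          by (simp add: inner_diff_left diff_divide_distrib right_diff_distrib)
        finally have "n / \<rho> * \<bar>(x - y) \<bullet> b\<bar> \<le> 1"
          using \<rho>(1) by (simp add: abs_mult)
        then show ?thesis
          using \<rho>(1) n(2) by (simp add: field_simps)
      qed
      then have "(\<Sum>b\<in>B. \<bar>(x - y) \<bullet> b\<bar>) \<le> (\<Sum>b\<in>B. \<rho> / n)"
        by (intro sum_mono)
      moreover have "x - y = (\<Sum>b\<in>B. ((x - y) \<bullet> b) *\<^sub>R b)"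
      proof -
        have "x - y \<in> span B"
          using xy assms(1,4) B(6) by (auto simp: cell_def intro: subspace_diff)
        then show ?thesis
          using orthonormal_basis_expand[OF B(2,3) _ finB] by metis
      qed
      then have "norm (x - y) \<le> (\<Sum>b\<in>B. norm (((x - y) \<bullet> b) *\<^sub>R b))"
        by (metis norm_sum)
      ultimately show "norm (x - y) \<le> d * \<rho> / n"
        using B(3,5) by (simp add: d_def)
    qed
    then have "(\<Sum>p\<in>F. diameter (cell p) ^ k) \<le> (\<Sum>p\<in>F. (d * \<rho> / n) ^ k)"
      using diameter_ge_0[OF bd] by (intro sum_mono power_mono)
    also have "\<dots> = (2 * real n + 1) ^ d * (d * \<rho>) ^ k / real n ^ k"
      by (simp add: F power_divide add.commute)
    also have "\<dots> \<le> (3 * real n) ^ d * (d * \<rho>) ^ k / real n ^ k"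
      using n(2) \<rho>(1) by (intro divide_right_mono mult_right_mono power_mono) auto
    also have "\<dots> = c * (real n ^ d / real n ^ k)"
      by (simp add: c_def power_mult_distrib)
    also have "\<dots> \<le> c * (1 / n)"
    proof (rule mult_left_mono)
      have "real n ^ (d + 1) \<le> real n ^ k"
        using n(2) assms(2) by (intro power_increasing) (auto simp: d_def)
      then show "real n ^ d / real n ^ k \<le> 1 / n"
        using n(2) by (simp add: field_simps)
      show "0 \<le> c" using \<rho>(1) by (simp add: c_def)
    qed
    also have "\<dots> \<le> e"
      using n \<open>0 < e\<close> by (simp add: field_simps)
    finally show ?thesis .
  qed
  ultimately show "\<exists>F f. finite (F :: ('a \<Rightarrow> int) set) \<and> Y \<subseteq> (\<Union>i\<in>F. f i) \<and>
      (\<forall>i\<in>F. bounded (f i)) \<and> (\<Sum>i\<in>F. diameter (f i) ^ k) \<le> e"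
    using F(1) by (intro exI[of _ F] exI[of _ cell]) auto
qed

section \<open>Almost sure absence of collisions\<close>

text \<open>Each covering set \<open>C i\<close> is represented by one of its points
  \<open>y i\<close>. If \<open>x\<close> collides with any admissible point of \<open>C i\<close>,
  then \<open>L\<close> nearly identifies \<open>x\<close> with \<open>y i\<close>, so it lies in a
  slab of width (\<Lambda> + R) times the diameter. Slab volumes are at most \<open>K\<close> times
  the \<open>k\<close>-th power of the diameter, with \<open>K\<close> uniform because
  \<open>L\<close> is bounded by \<open>R\<close> and |x - y i| is bounded below by
  \<delta>.\<close>

lemma negligible_perturb_collision:
  fixes \<phi> :: "real^'n \<Rightarrow> real^'k"
  assumes null: "hausdorff_null CARD('k) Y"
    and lip: "\<And>y z. y \<in> Y \<Longrightarrow> z \<in> Y \<Longrightarrow> norm (\<phi> y - \<phi> z) \<le> \<Lambda> * norm (y - z)"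
    and "0 \<le> \<Lambda>" "0 \<le> R" "0 < \<delta>"
  shows "negligible {L \<in> cball 0 R. \<exists>y\<in>Y. \<delta> \<le> norm (x - y) \<and> perturb \<phi> L x = perturb \<phi> L y}"
  unfolding negligible_outer_le
proof (intro allI impI)
  fix e :: real assume "0 < e"
  define K where "K = measure lebesgue (cball (0 :: real^'n^'k) (R + CARD('k)))
    * (3 * (\<Lambda> + R) / \<delta>) ^ CARD('k)"
  have "0 \<le> K" using assms by (simp add: K_def)
  then have "0 < e / (K + 1)"
    using \<open>0 < e\<close> by simp
  then obtain C :: "nat \<Rightarrow> (real^'n) set" where C: "Y \<subseteq> (\<Union>i. C i)" "\<And>i. bounded (C i)"
    "summable (\<lambda>i. diameter (C i) ^ CARD('k))" "(\<Sum>i. diameter (C i) ^ CARD('k)) \<le> e / (K + 1)"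
    using null unfolding hausdorff_null_def by blast
  define Q where "Q i y \<longleftrightarrow> y \<in> C i \<and> y \<in> Y \<and> \<delta> \<le> norm (x - y)" for i y
  \<comment> \<open>The representative must itself lie in \<open>Y\<close> and at distance at least
    \<delta> from \<open>x\<close>: the first gives the Lipschitz bound, the second bounds the slab.
    Without such a point the value of \<open>y i\<close> is arbitrary, and \<open>A i\<close> is
    empty.\<close>
  define y where "y i = (SOME y. Q i y)" for i
  define A where "A i = (if \<exists>y. Q i y then {L \<in> cball 0 R. norm (L *v (x - y i) + (\<phi> x - \<phi> (y i)))
      \<le> (\<Lambda> + R) * diameter (C i)} else {})" for i
  have y: "Q i (y i)" if "Q i z" for i z
    unfolding y_def using that by (rule someI)
  have diam: "0 \<le> diameter (C i)" for i
    using C(2) by (rule diameter_ge_0)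
  have A: "A i \<in> lmeasurable" for i
    unfolding A_def using lmeasurable_compact[OF compact_slab] by auto
  have mA: "measure lebesgue (A i) \<le> K * diameter (C i) ^ CARD('k)" for i
  proof (cases "\<exists>y. Q i y")
    case True
    then have Q: "Q i (y i)" using y by blast
    then have "x - y i \<noteq> 0" "\<delta> \<le> norm (x - y i)"
      using \<open>0 < \<delta>\<close> by (auto simp: Q_def)
    have "measure lebesgue (A i) \<le> measure lebesgue (cball (0 :: real^'n^'k) (R + CARD('k)))
        * (3 * ((\<Lambda> + R) * diameter (C i)) / norm (x - y i)) ^ CARD('k)"
      unfolding A_def if_P[OF True]
      using \<open>x - y i \<noteq> 0\<close> diam assms by (intro measure_slab_le) auto
    also have "\<dots> \<le> measure lebesgue (cball (0 :: real^'n^'k) (R + CARD('k)))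
        * (3 * ((\<Lambda> + R) * diameter (C i)) / \<delta>) ^ CARD('k)"
      using \<open>\<delta> \<le> norm (x - y i)\<close> diam assms \<open>x - y i \<noteq> 0\<close>
      by (intro mult_left_mono power_mono divide_left_mono mult_pos_pos) auto
    also have "3 * ((\<Lambda> + R) * diameter (C i)) / \<delta> = 3 * (\<Lambda> + R) / \<delta> * diameter (C i)"
      by simp
    also have "measure lebesgue (cball (0 :: real^'n^'k) (R + CARD('k))) * \<dots> ^ CARD('k)
        = K * diameter (C i) ^ CARD('k)"
      by (simp only: K_def power_mult_distrib mult.assoc)
    finally show ?thesis .
  next
    case False
    then show ?thesis using \<open>0 \<le> K\<close> diam by (simp add: A_def)
  qed
  have T: "(\<Union>i. A i) \<in> lmeasurable"
  proof (rule fmeasurableI2)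
    show "cball (0 :: real^'n^'k) R \<in> lmeasurable" by simp
    have "A i \<subseteq> cball 0 R" for i unfolding A_def by (cases "\<exists>y. Q i y") auto
    then show "(\<Union>i. A i) \<subseteq> cball 0 R" by blast
    show "(\<Union>i. A i) \<in> sets lebesgue" using fmeasurableD[OF A] by blast
  qed
  have "{L \<in> cball 0 R. \<exists>y\<in>Y. \<delta> \<le> norm (x - y) \<and> perturb \<phi> L x = perturb \<phi> L y} \<subseteq> (\<Union>i. A i)"
  proof safe
    fix L z assume L: "L \<in> cball 0 R" "z \<in> Y" "\<delta> \<le> norm (x - z)" "perturb \<phi> L x = perturb \<phi> L z"
    then obtain i where i: "z \<in> C i" using C(1) by blast
    with L have Q: "Q i z" by (simp add: Q_def)
    then have yi: "y i \<in> C i" "y i \<in> Y" using y by (auto simp: Q_def)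
    \<comment> \<open>The collision allows \<open>x\<close> to be exchanged for the nearby point
      \<open>z\<close>, after which only the variation inside \<open>C i\<close> remains.\<close>
    have "norm (L *v (x - y i) + (\<phi> x - \<phi> (y i))) = norm (L *v (z - y i) + (\<phi> z - \<phi> (y i)))"
    proof -
      have "L *v (u - y i) + (\<phi> u - \<phi> (y i)) = perturb \<phi> L u - perturb \<phi> L (y i)" for u
        by (simp add: perturb_def matrix_vector_mult_diff_distrib)
      then show ?thesis using L(4) by simp
    qed
    also have "\<dots> \<le> norm L * norm (z - y i) + \<Lambda> * norm (z - y i)"
      using norm_matrix_vector_mult_le lip[OF L(2) yi(2)] by (intro norm_triangle_mono)
    also have "\<dots> \<le> R * norm (z - y i) + \<Lambda> * norm (z - y i)"
      using L(1) by (intro add_right_mono mult_right_mono) auto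
    also have "\<dots> = (\<Lambda> + R) * norm (z - y i)" by (simp add: algebra_simps)
    also have "\<dots> \<le> (\<Lambda> + R) * diameter (C i)"
      using diameter_bounded_bound[OF C(2) i yi(1)] assms by (intro mult_left_mono) (auto simp: dist_norm)
    finally have "L \<in> A i"
      unfolding A_def using Q L(1) by (subst if_P) blast+
    then show "L \<in> (\<Union>i. A i)" by blast
  qed
  moreover have "measure lebesgue (\<Union>i. A i) \<le> e"
  proof -
    have "emeasure lebesgue (\<Union>i. A i) \<le> (\<Sum>i. emeasure lebesgue (A i))"
      using A by (intro emeasure_subadditive_countably) auto
    also have "\<dots> = (\<Sum>i. ennreal (measure lebesgue (A i)))"
      by (intro suminf_cong emeasure_eq_measure2 A)
    also have "\<dots> \<le> (\<Sum>i. ennreal (K * diameter (C i) ^ CARD('k)))"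
      by (intro suminf_le ennreal_leI mA summableI)
    also have "\<dots> = ennreal (\<Sum>i. K * diameter (C i) ^ CARD('k))"
      by (intro suminf_ennreal2 mult_nonneg_nonneg zero_le_power diam summable_mult C(3) \<open>0 \<le> K\<close>)
    also have "\<dots> \<le> ennreal e"
    proof (rule ennreal_leI)
      have "(\<Sum>i. K * diameter (C i) ^ CARD('k)) = K * (\<Sum>i. diameter (C i) ^ CARD('k))"
        using C(3) by (rule suminf_mult)
      also have "\<dots> \<le> K * (e / (K + 1))"
        using C(4) \<open>0 \<le> K\<close> by (rule mult_left_mono)
      also have "\<dots> \<le> e"
        using \<open>0 \<le> K\<close> \<open>0 < e\<close> by (simp add: field_simps)
      finally show "(\<Sum>i. K * diameter (C i) ^ CARD('k)) \<le> e" .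
    qed
    finally show ?thesis
      unfolding emeasure_eq_measure2[OF T] using \<open>0 < e\<close> by simp
  qed
  ultimately show "\<exists>T. {L \<in> cball 0 R. \<exists>y\<in>Y. \<delta> \<le> norm (x - y) \<and> perturb \<phi> L x = perturb \<phi> L y} \<subseteq> T
      \<and> T \<in> lmeasurable \<and> measure lebesgue T \<le> e"
    using T by blast
qed

text \<open>A single index \<open>j\<close> exhausts both restrictions of the previous lemma: the
  radius tends to infinity while the distance from \<open>x\<close> tends to 0.\<close>

lemma AE_perturb_no_collision:
  fixes \<phi> :: "real^'n \<Rightarrow> real^'k"
  assumes null: "hausdorff_null CARD('k) Y"
    and lip: "\<And>y z. y \<in> Y \<Longrightarrow> z \<in> Y \<Longrightarrow> norm (\<phi> y - \<phi> z) \<le> \<Lambda> * norm (y - z)"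
    and "0 \<le> \<Lambda>"
  shows "AE L in lebesgue. \<forall>y\<in>Y. y \<noteq> x \<longrightarrow> perturb \<phi> L x \<noteq> perturb \<phi> L y"
proof -
  define Bad where "Bad j = {L \<in> cball 0 (real j). \<exists>y\<in>Y. 1 / Suc j \<le> norm (x - y) \<and>
      perturb \<phi> L x = perturb \<phi> L y}" for j :: nat
  have "negligible (Bad j)" for j
    unfolding Bad_def by (rule negligible_perturb_collision[OF assms]) auto
  then have "negligible (\<Union>j. Bad j)"
    by (rule negligible_Union_nat)
  moreover have "{L. \<not> (\<forall>y\<in>Y. y \<noteq> x \<longrightarrow> perturb \<phi> L x \<noteq> perturb \<phi> L y)} \<subseteq> (\<Union>j. Bad j)"
  proof
    fix L assume "L \<in> {L. \<not> (\<forall>y\<in>Y. y \<noteq> x \<longrightarrow> perturb \<phi> L x \<noteq> perturb \<phi> L y)}"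
    then obtain y where y: "y \<in> Y" "y \<noteq> x" "perturb \<phi> L x = perturb \<phi> L y" by blast
    obtain i where "norm L \<le> real i" using real_arch_simple by blast
    obtain j where "inverse (real (Suc j)) < norm (x - y)"
      using reals_Archimedean[of "norm (x - y)"] y(2) by auto
    have "1 / Suc (max i j) \<le> 1 / Suc j"
      by (intro divide_left_mono) auto
    then have "1 / Suc (max i j) \<le> norm (x - y)"
      using \<open>inverse _ < _\<close> by (simp add: inverse_eq_divide)
    moreover have "norm L \<le> real (max i j)" using \<open>norm L \<le> real i\<close> by simp
    ultimately have "L \<in> Bad (max i j)"
      using y by (auto simp: Bad_def)
    then show "L \<in> (\<Union>j. Bad j)" by blast
  qed
  ultimately show ?thesis
    unfolding eventually_ae_filter_negligible by blast
qed

text \<open>Homogeneity saves one dimension. A nonzero \<open>t\<close> has a nonzero coordinate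
  along some basis vector \<open>b\<close> and can be scaled to make it 1; it then lies in
  \<open>b\<close> plus the span of the other basis vectors. These translates have dimension
  \<open>dim T - 1\<close>, which leaves room for the case \<open>dim T = CARD('k)\<close>.\<close>

lemma AE_perturb_injective_on_subspace:
  fixes A :: "real^'n \<Rightarrow> real^'k"
  assumes "subspace T" "dim T \<le> CARD('k)" "linear A"
  shows "AE L in lebesgue. \<forall>t\<in>T. t \<noteq> 0 \<longrightarrow> perturb A L t \<noteq> 0"
proof -
  obtain B where B: "B \<subseteq> T" "pairwise orthogonal B" "\<And>x. x \<in> B \<Longrightarrow> norm x = 1"
      "independent B" "card B = dim T" "span B = T"
    using orthonormal_basis_subspace[OF assms(1)] by metis
  have finB: "finite B"
    using B(4) independent_imp_finite by blast
  obtain \<Lambda> where \<Lambda>: "0 < \<Lambda>" "\<And>y. norm (A y) \<le> \<Lambda> * norm y"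
    using linear_bounded_pos[OF assms(3)] by metis
  \<comment> \<open>The nullity of a proper subspace is available for bounded pieces, so each affine
    hyperplane is exhausted by countably many of them.\<close>
  define Y where "Y b j = (+) b ` (span (B - {b}) \<inter> cball 0 (real j))" for b and j :: nat
  have "AE L in lebesgue. \<forall>y\<in>Y b j. y \<noteq> 0 \<longrightarrow> perturb A L 0 \<noteq> perturb A L y" if "b \<in> B" for b j
  proof (rule AE_perturb_no_collision)
    have "dim (B - {b}) \<le> card (B - {b})"
      using finB by (intro dim_le_card') auto
    moreover have "card (B - {b}) < card B"
      using finB that by (rule card_Diff1_less)
    ultimately have "dim (span (B - {b})) < CARD('k)"
      using assms(2) B(5) by (simp only: dim_span)
    then have "hausdorff_null CARD('k) (span (B - {b}) \<inter> cball 0 (real j))"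
      by (intro hausdorff_null_bounded_subspace[OF subspace_span]) auto
    then show "hausdorff_null CARD('k) (Y b j)"
      unfolding Y_def by (rule hausdorff_null_Lipschitz_image[where K = 1]) auto
    show "norm (A y - A z) \<le> \<Lambda> * norm (y - z)" for y z
      using \<Lambda>(2)[of "y - z"] by (simp add: linear_diff[OF assms(3)])
  qed (use \<Lambda> in simp)
  then have "AE L in lebesgue. \<forall>b\<in>B. \<forall>j. \<forall>y\<in>Y b j. y \<noteq> 0 \<longrightarrow> perturb A L 0 \<noteq> perturb A L y"
    using finB by (intro AE_finite_allI) (auto simp: AE_all_countable)
  then show ?thesis
  proof (rule eventually_mono, intro ballI impI)
    fix L t assume L: "\<forall>b\<in>B. \<forall>j. \<forall>y\<in>Y b j. y \<noteq> 0 \<longrightarrow> perturb A L 0 \<noteq> perturb A L y"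
      and t: "t \<in> T" "t \<noteq> 0"
    have ex: "(\<Sum>b\<in>B. (t \<bullet> b) *\<^sub>R b) = t"
      using orthonormal_basis_expand[OF B(2,3) _ finB] t B(6) by metis
    obtain b where b: "b \<in> B" "t \<bullet> b \<noteq> 0"
    proof (rule ccontr)
      assume "\<not> thesis"
      then have "\<forall>b\<in>B. t \<bullet> b = 0" using that by blast
      then have "(\<Sum>b\<in>B. (t \<bullet> b) *\<^sub>R b) = 0" by simp
      with ex t(2) show False by simp
    qed
    \<comment> \<open>What remains of \<open>t\<close> after division by its coordinate
      \<open>t \<bullet> b\<close> and removal of \<open>b\<close>.\<close>
    define s where "s = (\<Sum>c\<in>B - {b}. (t \<bullet> c / (t \<bullet> b)) *\<^sub>R c)"
    have ts: "t = (t \<bullet> b) *\<^sub>R (b + s)"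
      using b finB by (subst ex[symmetric])
        (simp add: s_def scaleR_add_right scaleR_sum_right sum.remove[of B b])
    have "s \<in> span (B - {b})"
      unfolding s_def by (intro span_sum span_scale span_base)
    moreover obtain j :: nat where "norm s \<le> j" using real_arch_simple by blast
    ultimately have "b + s \<in> Y b j"
      by (auto simp: Y_def)
    moreover have "b + s \<noteq> 0"
      using ts t(2) by force
    ultimately have "perturb A L 0 \<noteq> perturb A L (b + s)"
      using L b(1) by blast
    moreover have lin: "linear (perturb A L)"
      unfolding perturb_def by (intro linear_compose_add assms(3) matrix_vector_mul_linear)
    ultimately have "perturb A L (b + s) \<noteq> 0"
      using linear_0 by metis
    moreover have "perturb A L t = (t \<bullet> b) *\<^sub>R perturb A L (b + s)"
      by (subst ts) (rule linear_scale[OF lin])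
    ultimately show "perturb A L t \<noteq> 0"
      using b(2) by simp
  qed
qed

text \<open>Only for fixed \<open>x\<close> is the exceptional set of \<open>L\<close> under control, so the order of the
  quantifiers is exchanged by Fubini; the relevant set of pairs \<open>(x, L)\<close> is a countable union of
  closed sets.\<close>

lemma AE_perturb_expanding_Fubini:
  fixes \<phi> :: "real^'n \<Rightarrow> real^'k"
  assumes "compact Y" "X \<subseteq> Y" "X \<in> sets borel" "continuous_on Y \<phi>"
    and "prob_space \<mu>" "sets \<mu> = sets (restrict_space borel X)"
    and pointwise: "\<And>x. x \<in> X \<Longrightarrow> AE L in lebesgue.
      \<exists>C\<ge>0. \<forall>y\<in>Y. norm (x - y) \<le> C * norm (perturb \<phi> L x - perturb \<phi> L y)"
  shows "AE L in lebesgue. AE x in \<mu>.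
      \<exists>C\<ge>0. \<forall>y\<in>Y. norm (x - y) \<le> C * norm (perturb \<phi> L x - perturb \<phi> L y)"
proof -
  interpret \<mu>: prob_space \<mu> by fact
  interpret pair_sigma_finite \<mu> "lborel :: (real^'n^'k) measure" ..
  have sp: "space \<mu> = X"
    using sets_eq_imp_space_eq[OF assms(6)] by (simp add: space_restrict_space)
  define P where "P x L \<longleftrightarrow> (\<exists>C\<ge>0. \<forall>y\<in>Y. norm (x - y) \<le> C * norm (perturb \<phi> L x - perturb \<phi> L y))"
    for x L
  \<comment> \<open>Rounding \<open>C\<close> up to a natural number makes the union over
    \<open>j\<close> countable. For fixed \<open>j\<close> the uncountably many conditions indexed
    by \<open>y\<close> are an intersection of closed sets.\<close>
  define F where "F j = {p \<in> Y \<times> (UNIV :: (real^'n^'k) set). \<forall>y\<in>Y.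
      norm (fst p - y) \<le> real j * norm (perturb \<phi> (snd p) (fst p) - perturb \<phi> (snd p) y)}" for j :: nat
  have "closed (F j)" for j
  proof -
    have c: "closed (Y \<times> (UNIV :: (real^'n^'k) set))"
      by (intro closed_Times compact_imp_closed[OF assms(1)] closed_UNIV)
    have "continuous_on (Y \<times> (UNIV :: (real^'n^'k) set)) (\<lambda>p. \<phi> (fst p))"
      by (rule continuous_on_compose2[OF assms(4) continuous_on_fst[OF continuous_on_id]]) auto
    then have "closed {p \<in> Y \<times> (UNIV :: (real^'n^'k) set).
      norm (fst p - y) \<le> real j * norm (perturb \<phi> (snd p) (fst p) - perturb \<phi> (snd p) y)}" for y
      unfolding perturb_def by (intro continuous_on_closed_Collect_le continuous_intros c)
    then have "closed ((Y \<times> UNIV) \<inter> (\<Inter>y\<in>Y. {p \<in> Y \<times> (UNIV :: (real^'n^'k) set).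
      norm (fst p - y) \<le> real j * norm (perturb \<phi> (snd p) (fst p) - perturb \<phi> (snd p) y)}))"
      using c by (intro closed_Int closed_INT) auto
    moreover have "F j = (Y \<times> UNIV) \<inter> (\<Inter>y\<in>Y. {p \<in> Y \<times> (UNIV :: (real^'n^'k) set).
      norm (fst p - y) \<le> real j * norm (perturb \<phi> (snd p) (fst p) - perturb \<phi> (snd p) y)})"
      by (auto simp: F_def)
    ultimately show ?thesis by simp
  qed
  then have F: "(\<Union>j. F j) \<in> sets (borel \<Otimes>\<^sub>M borel)"
    unfolding borel_prod by (intro sets.countable_UN) auto
  have P_iff: "P x L \<longleftrightarrow> (x, L) \<in> (\<Union>j. F j)" if "x \<in> Y" for x L
  proof
    assume "P x L"
    then obtain C where C: "0 \<le> C" "\<And>y. y \<in> Y \<Longrightarrow> norm (x - y) \<le> C * norm (perturb \<phi> L x - perturb \<phi> L y)"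
      unfolding P_def by blast
    obtain j :: nat where "C \<le> j" using real_arch_simple by blast
    then have "norm (x - y) \<le> j * norm (perturb \<phi> L x - perturb \<phi> L y)" if "y \<in> Y" for y
      using C(2)[OF that] mult_right_mono[OF \<open>C \<le> j\<close>] order_trans norm_ge_zero by blast
    then show "(x, L) \<in> (\<Union>j. F j)"
      using that by (auto simp: F_def)
  next
    assume "(x, L) \<in> (\<Union>j. F j)"
    then obtain j where "(x, L) \<in> F j" by blast
    then show "P x L"
      unfolding P_def by (intro exI[of _ "real j"]) (auto simp: F_def)
  qed
  have id: "(\<lambda>x. x) \<in> measurable \<mu> borel"
  proof -
    have "(\<lambda>x. x) \<in> measurable (restrict_space borel X) (borel :: (real^'n) measure)"
      by (intro measurable_restrict_space1) auto
    then show ?thesis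
      using measurable_cong_sets[OF assms(6) refl] by blast
  qed
  \<comment> \<open>This is the identity map, split into components so that measurability can be
    checked for each. It passes from the subspace \<sigma>-algebra on \<open>X\<close>, which \<mu>
    carries, to the ambient Borel sets.\<close>
  have "(\<lambda>p. (fst p, snd p)) \<in> measurable (\<mu> \<Otimes>\<^sub>M (lborel :: (real^'n^'k) measure)) (borel \<Otimes>\<^sub>M borel)"
    using measurable_compose[OF measurable_fst id, of "lborel :: (real^'n^'k) measure"]
    by (intro measurable_Pair) auto
  then have "(\<lambda>p. (fst p, snd p)) -` (\<Union>j. F j) \<inter> space (\<mu> \<Otimes>\<^sub>M lborel) \<in> sets (\<mu> \<Otimes>\<^sub>M lborel)"
    using F by (rule measurable_sets)
  moreover have "(\<lambda>p. (fst p, snd p)) -` (\<Union>j. F j) \<inter> space (\<mu> \<Otimes>\<^sub>M lborel)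
      = {p \<in> space (\<mu> \<Otimes>\<^sub>M lborel). P (fst p) (snd p)}"
  proof -
    have "p \<in> (\<Union>j. F j) \<longleftrightarrow> P (fst p) (snd p)" if "p \<in> space (\<mu> \<Otimes>\<^sub>M lborel)" for p
    proof -
      have "fst p \<in> Y"
        using that assms(2) sp by (auto simp: space_pair_measure mem_Times_iff)
      then show ?thesis using P_iff[of "fst p" "snd p"] by simp
    qed
    then show ?thesis by (simp only: prod.collapse set_eq_iff vimage_def Int_iff mem_Collect_eq) blast
  qed
  ultimately have m: "{p \<in> space (\<mu> \<Otimes>\<^sub>M lborel). P (fst p) (snd p)} \<in> sets (\<mu> \<Otimes>\<^sub>M lborel)"
    by simp
  \<comment> \<open>Fubini is applied to \<open>lborel\<close>; its completion
    \<open>lebesgue\<close> has the same almost-everywhere statements, and the result is lifted back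
    at the end.\<close>
  have "AE L in lborel. P x L" if "x \<in> space \<mu>" for x
    using pointwise that unfolding sp P_def by (simp add: AE_completion_iff)
  then have "AE x in \<mu>. AE L in lborel. P x L" by (rule AE_I2)
  then have "AE L in lborel. AE x in \<mu>. P x L"
    using AE_commute[OF m] by simp
  then show ?thesis
    unfolding P_def by (rule AE_completion)
qed

section \<open>Submanifolds and \<open>C\<^sup>r\<close> maps\<close>

lemma Cr_on_open_imp_open: "Cr_on_open r S f \<Longrightarrow> open S"
  unfolding Cr_on_open_def by (rule conjunct1)

lemma Cr_on_open_imp_n_times_C_on: "Cr_on_open r S f \<Longrightarrow> enat n \<le> r \<Longrightarrow> n_times_C_on n S f"
  unfolding Cr_on_open_def by (drule conjunct2, drule spec, erule mp)

lemma Cr_on_open_if_n_times_C_on: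
  assumes "open S" "\<And>n. enat n \<le> r \<Longrightarrow> n_times_C_on n S f"
  shows "Cr_on_open r S f"
  unfolding Cr_on_open_def using assms by blast

lemma Cr_on_open_C1:
  assumes "Cr_on_open r S f" "1 \<le> r"
  shows "n_times_C_on (Suc 0) S f"
  by (rule Cr_on_open_imp_n_times_C_on[OF assms(1)]) (fact assms(2)[unfolded one_enat_def One_nat_def])

lemma Cr_on_open_add:
  assumes "Cr_on_open r S f" "Cr_on_open r S g"
  shows "Cr_on_open r S (\<lambda>x. f x + g x)"
proof (rule Cr_on_open_if_n_times_C_on)
  show "open S" by (rule Cr_on_open_imp_open[OF assms(1)])
  fix n assume n: "enat n \<le> r"
  show "n_times_C_on n S (\<lambda>x. f x + g x)"
    by (rule n_times_C_on_add[OF \<open>open S\<close> Cr_on_open_imp_n_times_C_on[OF assms(1) n]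
      Cr_on_open_imp_n_times_C_on[OF assms(2) n]])
qed

lemma Cr_on_open_subset:
  assumes "Cr_on_open r S f" "open S'" "S' \<subseteq> S"
  shows "Cr_on_open r S' f"
proof (rule Cr_on_open_if_n_times_C_on[OF assms(2)])
  fix n assume n: "enat n \<le> r"
  show "n_times_C_on n S' f"
    by (rule n_times_C_on_subset[OF Cr_on_open_imp_n_times_C_on[OF assms(1) n] assms(3)])
qed

lemma Cr_on_open_compose:
  assumes "Cr_on_open r S f" "Cr_on_open r T g" "f ` S \<subseteq> T"
  shows "Cr_on_open r S (\<lambda>x. g (f x))"
proof (rule Cr_on_open_if_n_times_C_on)
  show "open S" by (rule Cr_on_open_imp_open[OF assms(1)])
  fix n assume n: "enat n \<le> r"
  show "n_times_C_on n S (\<lambda>x. g (f x))"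
    by (rule n_times_C_on_compose[OF \<open>open S\<close> Cr_on_open_imp_n_times_C_on[OF assms(1) n]
      Cr_on_open_imp_n_times_C_on[OF assms(2) n] assms(3)])
qed

lemma Cr_on_open_const: "open S \<Longrightarrow> Cr_on_open r S (\<lambda>x. c)"
  using n_times_C_on_const[of S _ c] by (intro Cr_on_open_if_n_times_C_on)

lemma Cr_on_open_bounded_linear: "bounded_linear h \<Longrightarrow> open S \<Longrightarrow> Cr_on_open r S h"
  using n_times_C_on_bounded_linear[of h S] by (intro Cr_on_open_if_n_times_C_on)

lemma Cr_on_open_has_derivative:
  assumes "Cr_on_open r S f" "1 \<le> r" "x \<in> S"
  shows "(f has_derivative frechet_derivative f (at x)) (at x)"
  by (rule n_times_C_on_SucD[OF Cr_on_open_C1[OF assms(1,2)] assms(3)])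

lemma Cr_on_open_continuous:
  assumes "Cr_on_open r S f"
  shows "continuous_on S f"
proof -
  have "n_times_C_on 0 S f"
    by (rule Cr_on_open_imp_n_times_C_on[OF assms]) (simp flip: zero_enat_def)
  then show ?thesis by simp
qed

lemma Cr_onE:
  assumes "Cr_on r A f" "p \<in> A"
  obtains W g where "p \<in> W" "Cr_on_open r W g" "\<And>y. y \<in> A \<inter> W \<Longrightarrow> g y = f y"
proof -
  have "\<exists>W g. p \<in> W \<and> Cr_on_open r W g \<and> (\<forall>x\<in>A \<inter> W. g x = f x)"
    using assms unfolding Cr_on_def by (rule bspec)
  then obtain W g where "p \<in> W" "Cr_on_open r W g" "\<forall>x\<in>A \<inter> W. g x = f x"
    by (elim exE conjE)
  then show ?thesis using that[of W g] by simp
qed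

text \<open>A local extension agrees with \<open>f\<close> on an open neighbourhood inside
  \<open>S\<close>, so it has the same derivatives there. Through this lemma chart maps, whose
  smoothness is stated by \<open>Cr_on\<close>, can be differentiated.\<close>

lemma Cr_on_openI:
  assumes "open S" "Cr_on r S f"
  shows "Cr_on_open r S f"
proof (rule Cr_on_open_if_n_times_C_on[OF assms(1)])
  fix n assume n: "enat n \<le> r"
  show "n_times_C_on n S f"
  proof (rule n_times_C_on_local)
    fix x assume "x \<in> S"
    obtain W g where W: "x \<in> W" "Cr_on_open r W g" "\<And>y. y \<in> S \<inter> W \<Longrightarrow> g y = f y"
      by (fact Cr_onE[OF assms(2) \<open>x \<in> S\<close>])
    then have "open (S \<inter> W)" "n_times_C_on n (S \<inter> W) g"
      using assms(1) n_times_C_on_subset[OF Cr_on_open_imp_n_times_C_on[OF W(2) n]]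
        Cr_on_open_imp_open[OF W(2)] by auto
    then have "n_times_C_on n (S \<inter> W) f"
      using W(3) by (rule n_times_C_on_cong)
    then show "\<exists>W. open W \<and> x \<in> W \<and> n_times_C_on n W f"
      using \<open>open (S \<inter> W)\<close> \<open>x \<in> S\<close> W(1) by blast
  qed
qed

lemma Cr_on_subset:
  assumes "Cr_on r A f" "B \<subseteq> A"
  shows "Cr_on r B f"
  unfolding Cr_on_def
proof
  fix p assume "p \<in> B"
  with assms(2) have "p \<in> A" by (rule subsetD)
  obtain W g where W: "p \<in> W" "Cr_on_open r W g" "\<And>y. y \<in> A \<inter> W \<Longrightarrow> g y = f y"
    by (fact Cr_onE[OF assms(1) \<open>p \<in> A\<close>])
  have "\<forall>y\<in>B \<inter> W. g y = f y" using W(3) assms(2) by blast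
  then show "\<exists>W g. p \<in> W \<and> Cr_on_open r W g \<and> (\<forall>y\<in>B \<inter> W. g y = f y)"
    using W(1,2) by (intro exI conjI)
qed

lemma Cr_onI:
  assumes "Cr_on_open r W g" "A \<subseteq> W" "\<And>x. x \<in> A \<Longrightarrow> g x = f x"
  shows "Cr_on r A f"
  unfolding Cr_on_def
proof
  fix p assume "p \<in> A"
  then have "p \<in> W" "\<forall>x\<in>A \<inter> W. g x = f x" using assms(2,3) by blast+
  then show "\<exists>W g. p \<in> W \<and> Cr_on_open r W g \<and> (\<forall>x\<in>A \<inter> W. g x = f x)"
    using assms(1) by (intro exI conjI)
qed

lemma Cr_on_continuous:
  assumes "Cr_on r A f"
  shows "continuous_on A f"
  unfolding continuous_on_eq_continuous_within
proof
  fix x assume "x \<in> A"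
  obtain W g where W: "x \<in> W" "Cr_on_open r W g" "\<And>y. y \<in> A \<inter> W \<Longrightarrow> g y = f y"
    by (fact Cr_onE[OF assms \<open>x \<in> A\<close>])
  then have o: "open W" by (simp add: Cr_on_open_imp_open)
  have "continuous (at x within A) g"
    using Cr_on_open_continuous[OF W(2)] W(1) o
    by (simp add: continuous_on_eq_continuous_at continuous_at_imp_continuous_at_within)
  moreover obtain d where "d > 0" "ball x d \<subseteq> W"
    using o W(1) open_contains_ball by blast
  ultimately show "continuous (at x within A) f"
    using W(3) \<open>x \<in> A\<close>
    by (intro continuous_transform_within[of x A g d f]) (auto simp: subset_iff dist_commute)
qed

lemma Cr_on_perturb:
  fixes \<phi> :: "real^'n \<Rightarrow> real^'k"
  assumes "Cr_on r M \<phi>"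
  shows "Cr_on r M (perturb \<phi> L)"
  unfolding Cr_on_def
proof
  fix p assume "p \<in> M"
  obtain W g where W: "p \<in> W" "Cr_on_open r W g" "\<And>y. y \<in> M \<inter> W \<Longrightarrow> g y = \<phi> y"
    by (fact Cr_onE[OF assms \<open>p \<in> M\<close>])
  have "Cr_on_open r W (perturb g L)"
    unfolding perturb_def
    by (rule Cr_on_open_add[OF W(2) Cr_on_open_bounded_linear[OF matrix_vector_mul_bounded_linear
            Cr_on_open_imp_open[OF W(2)]]])
  moreover have "\<forall>x\<in>M \<inter> W. perturb g L x = perturb \<phi> L x"
    using W(3) by (simp add: perturb_def)
  ultimately show "\<exists>W g. p \<in> W \<and> Cr_on_open r W g \<and> (\<forall>x\<in>M \<inter> W. g x = perturb \<phi> L x)"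
    using W(1) by blast
qed

text \<open>The definition gives continuity of each directional derivative separately. The operator
  norm is therefore bounded by the sum of the norms of the partial derivatives, which is bounded on
  a compact ball; the mean value inequality on this convex ball does the rest.\<close>

lemma Cr_on_open_locally_Lipschitz:
  assumes "Cr_on_open r S f" "1 \<le> r" "p \<in> S"
  obtains K \<rho> where "0 \<le> K" "0 < \<rho>" "cball p \<rho> \<subseteq> S"
    "\<And>x y. x \<in> cball p \<rho> \<Longrightarrow> y \<in> cball p \<rho> \<Longrightarrow> norm (f x - f y) \<le> K * norm (x - y)"
proof -
  let ?D = "\<lambda>x. frechet_derivative f (at x)"
  have "open S" using assms(1) by (simp add: Cr_on_open_imp_open)
  then obtain \<rho> where \<rho>: "0 < \<rho>" "cball p \<rho> \<subseteq> S"
    using assms(3) open_contains_cball by blast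
  have "continuous_on S (\<lambda>x. ?D x b)" for b
    using Cr_on_open_C1[OF assms(1,2)] by simp
  then have "continuous_on (cball p \<rho>) (\<lambda>x. \<Sum>b\<in>Basis. norm (?D x b))"
    using \<rho>(2) by (intro continuous_intros) (auto intro: continuous_on_subset)
  then have "compact ((\<lambda>x. \<Sum>b\<in>Basis. norm (?D x b)) ` cball p \<rho>)"
    by (intro compact_continuous_image compact_cball)
  then obtain K where K0: "0 < K" "\<forall>z\<in>(\<lambda>x. \<Sum>b\<in>Basis. norm (?D x b)) ` cball p \<rho>. norm z \<le> K"
    using compact_imp_bounded bounded_pos by blast
  have K: "(\<Sum>b\<in>Basis. norm (?D x b)) \<le> K" if "x \<in> cball p \<rho>" for x
    using bspec[OF K0(2) imageI[OF that]] abs_le_D1 unfolding real_norm_def by blast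
  have der: "(f has_derivative ?D x) (at x)" if "x \<in> cball p \<rho>" for x
    using Cr_on_open_has_derivative[OF assms(1,2)] \<rho>(2) that by blast
  have "onorm (?D x) \<le> K" if x: "x \<in> cball p \<rho>" for x
  proof (rule onorm_le)
    fix v
    have lin: "linear (?D x)" using der[OF x] has_derivative_linear by blast
    have "?D x v = ?D x (\<Sum>b\<in>Basis. (v \<bullet> b) *\<^sub>R b)"
      by (simp add: euclidean_representation)
    also have "\<dots> = (\<Sum>b\<in>Basis. (v \<bullet> b) *\<^sub>R ?D x b)"
      by (simp add: linear_sum[OF lin] linear_scale[OF lin])
    finally have "norm (?D x v) \<le> (\<Sum>b\<in>Basis. norm ((v \<bullet> b) *\<^sub>R ?D x b))"
      by (metis norm_sum)
    also have "\<dots> \<le> (\<Sum>b\<in>Basis. norm v * norm (?D x b))"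
      by (intro sum_mono) (simp add: mult_right_mono Basis_le_norm)
    also have "\<dots> = norm v * (\<Sum>b\<in>Basis. norm (?D x b))"
      by (simp add: sum_distrib_left)
    also have "\<dots> \<le> norm v * K"
      using K[OF x] by (intro mult_left_mono) auto
    finally show "norm (?D x v) \<le> K * norm v" by (simp add: mult.commute)
  qed
  then have "norm (f x - f y) \<le> K * norm (x - y)" if "x \<in> cball p \<rho>" "y \<in> cball p \<rho>" for x y
    using that der
    by (intro differentiable_bound[OF convex_cball, of p \<rho> f ?D]) (auto intro: has_derivative_at_withinI)
  then show ?thesis
    by (rule that[OF less_imp_le[OF K0(1)] \<rho>])
qed

section \<open>Slice charts and local expansion\<close>

text \<open>Repackages a slice chart with an explicit two-sided inverse \<open>h\<close>,
  \<open>C\<^sup>r\<close> on an open set, in place of \<open>inv_into\<close>. Injectivity of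
  \<psi> turns the slice equation between images into a pointwise test for membership in
  \<open>M\<close>.\<close>

lemma submanifold_chart:
  fixes M :: "'a::euclidean_space set"
  assumes "embedded_Cr_submanifold r m M" "p \<in> M"
  obtains W and \<psi> :: "'a \<Rightarrow> 'a" and W' h T where "p \<in> W" "Cr_on_open r W \<psi>" "Cr_on_open r W' h"
    "\<And>x. x \<in> W \<Longrightarrow> \<psi> x \<in> W' \<and> h (\<psi> x) = x" "\<And>y. y \<in> W' \<Longrightarrow> h y \<in> W \<and> \<psi> (h y) = y"
    "subspace T" "dim T = m" "\<And>x. x \<in> W \<Longrightarrow> x \<in> M \<longleftrightarrow> \<psi> x \<in> T"
proof -
  obtain W W' \<psi> and T :: "'a set" where W: "open W" "p \<in> W" "open (W' :: 'a set)"
      "Cr_diffeomorphism r W W' \<psi>" "subspace T" "dim T = m" "\<psi> ` (M \<inter> W) = T \<inter> W'"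
    using assms unfolding embedded_Cr_submanifold_def by metis
  then have bij: "bij_betw \<psi> W W'" and C: "Cr_on r W \<psi>" "Cr_on r W' (inv_into W \<psi>)"
    by (auto simp: Cr_diffeomorphism_def)
  have a: "\<psi> x \<in> W' \<and> inv_into W \<psi> (\<psi> x) = x" if "x \<in> W" for x
    using bij that by (metis bij_betw_apply bij_betw_inv_into_left)
  have b: "inv_into W \<psi> y \<in> W \<and> \<psi> (inv_into W \<psi> y) = y" if "y \<in> W'" for y
    using bij that by (metis bij_betw_imp_surj_on bij_betw_inv_into_right inv_into_into)
  have "x \<in> M \<longleftrightarrow> \<psi> x \<in> T" if x: "x \<in> W" for x
  proof
    assume "\<psi> x \<in> T"
    then have "\<psi> x \<in> \<psi> ` (M \<inter> W)" using W(7) a[OF x] by blast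
    then obtain y where "y \<in> M" "y \<in> W" "\<psi> x = \<psi> y" by blast
    then show "x \<in> M" using a x by metis
  qed (use W(7) x in blast)
  with a b W show ?thesis
    by (intro that[OF W(2) Cr_on_openI[OF W(1) C(1)] Cr_on_openI[OF W(3) C(2)]]) auto
qed

text \<open>Near \<open>p\<close> the manifold is a Lipschitz image, under the inverse chart, of a
  bounded piece of the \<open>m\<close>-dimensional slice \<open>T\<close>.\<close>

lemma submanifold_locally_hausdorff_null:
  fixes M :: "'a::euclidean_space set"
  assumes "embedded_Cr_submanifold r m M" "1 \<le> r" "p \<in> M" "m < k"
  shows "\<exists>W. open W \<and> p \<in> W \<and> hausdorff_null k (M \<inter> W)"
proof -
  obtain W and \<psi> :: "'a \<Rightarrow> 'a" and W' h T where W: "p \<in> W" "Cr_on_open r W \<psi>" "Cr_on_open r W' h"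
    "\<And>x. x \<in> W \<Longrightarrow> \<psi> x \<in> W' \<and> h (\<psi> x) = x" "\<And>y. y \<in> W' \<Longrightarrow> h y \<in> W \<and> \<psi> (h y) = y"
    "subspace T" "dim T = m" "\<And>x. x \<in> W \<Longrightarrow> x \<in> M \<longleftrightarrow> \<psi> x \<in> T"
    by (fact submanifold_chart[OF assms(1,3)])
  have "\<psi> p \<in> W'" using W(1,4) by blast
  obtain K \<rho> where K: "0 \<le> K" "0 < \<rho>" "cball (\<psi> p) \<rho> \<subseteq> W'"
    "\<And>x y. x \<in> cball (\<psi> p) \<rho> \<Longrightarrow> y \<in> cball (\<psi> p) \<rho> \<Longrightarrow> norm (h x - h y) \<le> K * norm (x - y)"
    by (fact Cr_on_open_locally_Lipschitz[OF W(3) assms(2) \<open>\<psi> p \<in> W'\<close>])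
  have "hausdorff_null k (T \<inter> cball (\<psi> p) \<rho>)"
    using W(6,7) assms(4) by (intro hausdorff_null_bounded_subspace[OF W(6)]) auto
  then have null: "hausdorff_null k (h ` (T \<inter> cball (\<psi> p) \<rho>))"
    using K by (intro hausdorff_null_Lipschitz_image[where K = K]) auto
  define O' where "O' = W \<inter> \<psi> -` ball (\<psi> p) \<rho>"
  have "open O'"
    unfolding O'_def
    by (intro continuous_open_preimage Cr_on_open_continuous[OF W(2)] Cr_on_open_imp_open[OF W(2)] open_ball)
  moreover have "p \<in> O'" using W(1) K(2) by (simp add: O'_def)
  moreover have "M \<inter> O' \<subseteq> h ` (T \<inter> cball (\<psi> p) \<rho>)"
  proof
    fix x assume "x \<in> M \<inter> O'"
    then have "x = h (\<psi> x)" "\<psi> x \<in> T \<inter> cball (\<psi> p) \<rho>"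
      using W(4,8) by (auto simp: O'_def)
    then show "x \<in> h ` (T \<inter> cball (\<psi> p) \<rho>)" by blast
  qed
  ultimately show ?thesis
    using hausdorff_null_subset[OF null] by blast
qed

text \<open>Injectivity on \<open>T\<close> gives |f' t| \<ge> e |t|; half of this is spent on the
  linearisation error of \<open>f\<close>, and |h t - h q| \<le> (B + 1) |t - q| near
  \<open>q\<close>. Hence \<open>c = e / (2 * (B + 1))\<close>. One endpoint stays at
  \<open>q\<close>, so only the derivatives at \<open>q\<close> enter. In the application
  \<open>h\<close> is an inverse chart and \<open>f\<close> is the perturbed map in that
  chart.\<close>

lemma immersion_locally_expanding:
  fixes h :: "'a::euclidean_space \<Rightarrow> 'b::euclidean_space" and f :: "'a \<Rightarrow> 'c::euclidean_space"
  assumes "(h has_derivative h') (at q)" "(f has_derivative f') (at q)" "subspace T" "q \<in> T"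
    and inj: "\<And>t. t \<in> T \<Longrightarrow> f' t = 0 \<Longrightarrow> t = 0"
  shows "\<exists>c>0. \<exists>\<rho>>0. \<forall>t\<in>T \<inter> ball q \<rho>. c * norm (h q - h t) \<le> norm (f q - f t)"
proof -
  have "bounded_linear f'" using assms(2) has_derivative_bounded_linear by blast
  then obtain e where e: "0 < e" "\<And>t. t \<in> T \<Longrightarrow> e * norm t \<le> norm (f' t)"
    using injective_imp_isometric[OF closed_subspace[OF assms(3)] assms(3), of f'] inj by blast
  obtain B where B: "0 < B" "\<And>v. norm (h' v) \<le> norm v * B"
    using bounded_linear.pos_bounded[OF has_derivative_bounded_linear[OF assms(1)]] by blast
  have "0 < e / 2" using e by simp
  then obtain d1 where d1: "0 < d1" "\<And>t. norm (t - q) < d1 \<Longrightarrow> norm (f t - f q - f' (t - q)) \<le> e / 2 * norm (t - q)"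
    using assms(2) unfolding has_derivative_at_alt by blast
  obtain d2 where d2: "0 < d2" "\<And>t. norm (t - q) < d2 \<Longrightarrow> norm (h t - h q - h' (t - q)) \<le> 1 * norm (t - q)"
    using assms(1) unfolding has_derivative_at_alt by (meson zero_less_one)
  have "e / 2 / (B + 1) * norm (h q - h t) \<le> norm (f q - f t)" if t: "t \<in> T" "norm (t - q) < min d1 d2" for t
  proof -
    have tq: "t - q \<in> T" using assms(3,4) t subspace_diff by blast
    have "norm (h t - h q) \<le> norm (h t - h q - h' (t - q)) + norm (h' (t - q))"
      by (metis diff_add_cancel norm_triangle_ineq)
    also have "\<dots> \<le> 1 * norm (t - q) + norm (t - q) * B"
      using d2(2)[of t] B(2)[of "t - q"] t by (intro add_mono) auto
    finally have "norm (h t - h q) \<le> (B + 1) * norm (t - q)" by (simp add: algebra_simps)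
    then have "e / 2 / (B + 1) * norm (h t - h q) \<le> e / 2 / (B + 1) * ((B + 1) * norm (t - q))"
      using e B(1) by (intro mult_left_mono) auto
    also have "\<dots> = e * norm (t - q) - e / 2 * norm (t - q)"
      using B(1) by (simp add: field_simps)
    also have "\<dots> \<le> norm (f' (t - q)) - norm (f t - f q - f' (t - q))"
      using e(2)[OF tq] d1(2)[of t] t by (intro diff_mono) auto
    also have "\<dots> \<le> norm (f t - f q)"
      using norm_triangle_ineq2[of "f' (t - q)" "f' (t - q) - (f t - f q)"]
      by (simp add: norm_minus_commute)
    finally show ?thesis by (simp add: norm_minus_commute)
  qed
  then show ?thesis
    using e B(1) d1(1) d2(1)
    by (intro exI[of _ "e / 2 / (B + 1)"] conjI exI[of _ "min d1 d2"])
      (auto simp: dist_norm norm_minus_commute)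
qed

text \<open>The tangent space of \<open>M\<close> at \<open>x\<close> is the image of
  \<open>T\<close> under \<open>h'\<close>. Perturbing commutes with differentiating:
  \<open>perturb g L\<close> has derivative \<open>perturb A L\<close> at \<open>x\<close>. The null
  set of bad matrices thus depends only on \<open>A\<close> and the tangent space.\<close>

lemma AE_perturb_locally_expanding:
  fixes \<phi> :: "real^'n \<Rightarrow> real^'k"
  assumes "1 \<le> r" "embedded_Cr_submanifold r m M" "Cr_on r M \<phi>" "m \<le> CARD('k)" "x \<in> M"
  shows "AE L in lebesgue. \<exists>c>0. \<exists>\<rho>>0. \<forall>y\<in>M \<inter> ball x \<rho>.
    c * norm (x - y) \<le> norm (perturb \<phi> L x - perturb \<phi> L y)"
proof -
  obtain W and \<psi> :: "real^'n \<Rightarrow> real^'n" and W' h T where W: "x \<in> W" "Cr_on_open r W \<psi>" "Cr_on_open r W' h"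
    "\<And>x. x \<in> W \<Longrightarrow> \<psi> x \<in> W' \<and> h (\<psi> x) = x" "\<And>y. y \<in> W' \<Longrightarrow> h y \<in> W \<and> \<psi> (h y) = y"
    "subspace T" "dim T = m" "\<And>x. x \<in> W \<Longrightarrow> x \<in> M \<longleftrightarrow> \<psi> x \<in> T"
    by (fact submanifold_chart[OF assms(2,5)])
  obtain W0 g where W0: "x \<in> W0" "Cr_on_open r W0 g" "\<And>y. y \<in> M \<inter> W0 \<Longrightarrow> g y = \<phi> y"
    by (fact Cr_onE[OF assms(3,5)])
  note op = Cr_on_open_imp_open[OF W(2)] Cr_on_open_imp_open[OF W0(2)] Cr_on_open_imp_open[OF W(3)]
  define q where "q = \<psi> x"
  have q: "q \<in> W'" "h q = x" "q \<in> T"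
    using W(1,4,8) assms(5) by (auto simp: q_def)
  define h' where "h' = frechet_derivative h (at q)"
  define A where "A = frechet_derivative g (at x)"
  define \<psi>' where "\<psi>' = frechet_derivative \<psi> (at x)"
  have dh: "(h has_derivative h') (at q)"
    unfolding h'_def by (rule Cr_on_open_has_derivative[OF W(3) assms(1) q(1)])
  have d\<psi>: "(\<psi> has_derivative \<psi>') (at (h q))"
    unfolding \<psi>'_def q(2) by (rule Cr_on_open_has_derivative[OF W(2) assms(1) W(1)])
  have dg: "(g has_derivative A) (at x)"
    unfolding A_def by (rule Cr_on_open_has_derivative[OF W0(2) assms(1) W0(1)])
  have lin: "linear h'" "linear A"
    using dh dg has_derivative_linear by blast+
  \<comment> \<open>Differentiating \<open>\<psi> (h t) = t\<close> provides a left inverse of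
    \<open>h'\<close>, so injectivity on the tangent space pulls back to \<open>T\<close>.\<close>
  have "((\<lambda>t. \<psi> (h t)) has_derivative (\<lambda>v. \<psi>' (h' v))) (at q)"
    by (rule has_derivative_compose[OF dh d\<psi>])
  moreover have "((\<lambda>t. \<psi> (h t)) has_derivative (\<lambda>v. v)) (at q)"
    by (rule has_derivative_transform_within_open[OF has_derivative_ident op(3) q(1)]) (simp add: W(5))
  ultimately have \<psi>h: "\<psi>' (h' v) = v" for v
    using has_derivative_unique by metis
  have "dim (h' ` T) \<le> CARD('k)"
    using dim_image_le[OF lin(1), of T] W(7) assms(4) by simp
  then have "AE L in lebesgue. \<forall>t\<in>h' ` T. t \<noteq> 0 \<longrightarrow> perturb A L t \<noteq> 0"
    by (intro AE_perturb_injective_on_subspace linear_subspace_image lin W(6))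
  then show ?thesis
  proof (rule eventually_mono)
    fix L assume L: "\<forall>t\<in>h' ` T. t \<noteq> 0 \<longrightarrow> perturb A L t \<noteq> 0"
    define f where "f t = perturb g L (h t)" for t
    have "(perturb g L has_derivative perturb A L) (at (h q))"
      unfolding perturb_def q(2)
      by (intro has_derivative_add dg bounded_linear_imp_has_derivative matrix_vector_mul_bounded_linear)
    then have "(f has_derivative (\<lambda>v. perturb A L (h' v))) (at q)"
      unfolding f_def by (rule has_derivative_compose[OF dh])
    moreover have "t = 0" if "t \<in> T" "perturb A L (h' t) = 0" for t
    proof -
      have "h' t = 0" using L that by blast
      then show ?thesis using \<psi>h[of t] \<psi>h[of 0] linear_0[OF lin(1)] by simp
    qed
    ultimately obtain c \<rho> where c: "0 < c" "0 < \<rho>"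
        "\<And>t. t \<in> T \<inter> ball q \<rho> \<Longrightarrow> c * norm (h q - h t) \<le> norm (f q - f t)"
      using immersion_locally_expanding[OF dh _ W(6) q(3), of f "\<lambda>v. perturb A L (h' v)"] by blast
    have "open (W0 \<inter> (W \<inter> \<psi> -` ball q \<rho>))"
      using Cr_on_open_continuous[OF W(2)] op by (intro open_Int continuous_open_preimage) auto
    moreover have "x \<in> W0 \<inter> (W \<inter> \<psi> -` ball q \<rho>)"
      using W(1) W0(1) c(2) by (simp add: q_def)
    ultimately obtain \<rho>' where \<rho>': "0 < \<rho>'" "ball x \<rho>' \<subseteq> W0 \<inter> (W \<inter> \<psi> -` ball q \<rho>)"
      using open_contains_ball by blast
    have "c * norm (x - y) \<le> norm (perturb \<phi> L x - perturb \<phi> L y)" if "y \<in> M \<inter> ball x \<rho>'" for y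
    proof -
      have y: "y \<in> M" "y \<in> W0" "y \<in> W" "\<psi> y \<in> ball q \<rho>" using that \<rho>'(2) by auto
      then have "\<psi> y \<in> T" "h (\<psi> y) = y" using W(4,8) by blast+
      moreover have "f q = perturb \<phi> L x" "f (\<psi> y) = perturb \<phi> L y"
        using W0(1,3) assms(5) y q(2) \<open>h (\<psi> y) = y\<close> by (simp_all add: f_def perturb_def)
      ultimately show ?thesis using c(3)[of "\<psi> y"] y(4) q(2) by auto
    qed
    then show "\<exists>c>0. \<exists>\<rho>>0. \<forall>y\<in>M \<inter> ball x \<rho>. c * norm (x - y) \<le> norm (perturb \<phi> L x - perturb \<phi> L y)"
      using c(1) \<rho>'(1) by blast
  qed
qed

text \<open>Inside a small ball around \<open>x\<close> local expansion gives the estimate. On the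
  compact remainder of \<open>Y\<close> the images stay at a positive distance from that of
  \<open>x\<close>, since collisions are excluded, and |x - y| is bounded.\<close>

lemma AE_perturb_expanding_at:
  fixes \<phi> :: "real^'n \<Rightarrow> real^'k"
  assumes "1 \<le> r" "embedded_Cr_submanifold r m M" "Cr_on r M \<phi>" "m \<le> CARD('k)"
    and "compact Y" "Y \<subseteq> M" "x \<in> Y"
    and null: "\<And>p. p \<in> Y \<Longrightarrow> \<exists>W. open W \<and> p \<in> W \<and> hausdorff_null CARD('k) (Y \<inter> W)"
  shows "AE L in lebesgue. \<exists>C\<ge>0. \<forall>y\<in>Y. norm (x - y) \<le> C * norm (perturb \<phi> L x - perturb \<phi> L y)"
proof -
  \<comment> \<open>Both the nullity of \<open>Y\<close> and the Lipschitz bounds from extensions of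
    \<phi> are local, so collisions are excluded near each \<open>p\<close> separately; a finite
    subcover then leaves finitely many null sets.\<close>
  have "\<exists>W. open W \<and> p \<in> W \<and> (AE L in lebesgue. \<forall>y\<in>Y \<inter> W. y \<noteq> x \<longrightarrow> perturb \<phi> L x \<noteq> perturb \<phi> L y)"
    if p: "p \<in> Y" for p
  proof -
    obtain W where W: "open W" "p \<in> W" "hausdorff_null CARD('k) (Y \<inter> W)"
      using null[OF p] by blast
    have "p \<in> M" using p assms(6) by blast
    obtain W0 g where W0: "p \<in> W0" "Cr_on_open r W0 g" "\<And>y. y \<in> M \<inter> W0 \<Longrightarrow> g y = \<phi> y"
      by (fact Cr_onE[OF assms(3) \<open>p \<in> M\<close>])
    obtain K \<rho> where K: "0 \<le> K" "0 < \<rho>" "cball p \<rho> \<subseteq> W0"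
      "\<And>x y. x \<in> cball p \<rho> \<Longrightarrow> y \<in> cball p \<rho> \<Longrightarrow> norm (g x - g y) \<le> K * norm (x - y)"
      by (fact Cr_on_open_locally_Lipschitz[OF W0(2) assms(1) W0(1)])
    have "AE L in lebesgue. \<forall>y\<in>Y \<inter> (W \<inter> ball p \<rho>). y \<noteq> x \<longrightarrow> perturb \<phi> L x \<noteq> perturb \<phi> L y"
    proof (rule AE_perturb_no_collision[OF _ _ K(1)])
      show "hausdorff_null CARD('k) (Y \<inter> (W \<inter> ball p \<rho>))"
        using W(3) by (rule hausdorff_null_subset) blast
      fix y z assume "y \<in> Y \<inter> (W \<inter> ball p \<rho>)" "z \<in> Y \<inter> (W \<inter> ball p \<rho>)"
      moreover from this have "y \<in> M \<inter> W0" "z \<in> M \<inter> W0"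
        using assms(6) K(3) ball_subset_cball by blast+
      ultimately show "norm (\<phi> y - \<phi> z) \<le> K * norm (y - z)"
        using K(4)[of y z] W0(3) by auto
    qed
    then show ?thesis
      using W(1,2) K(2) by (intro exI[of _ "W \<inter> ball p \<rho>"]) auto
  qed
  then have "\<forall>p\<in>Y. \<exists>W. open W \<and> p \<in> W \<and>
      (AE L in lebesgue. \<forall>y\<in>Y \<inter> W. y \<noteq> x \<longrightarrow> perturb \<phi> L x \<noteq> perturb \<phi> L y)" by (rule ballI)
  from bchoice[OF this] obtain N where N: "\<And>p. p \<in> Y \<Longrightarrow> open (N p) \<and> p \<in> N p \<and>
      (AE L in lebesgue. \<forall>y\<in>Y \<inter> N p. y \<noteq> x \<longrightarrow> perturb \<phi> L x \<noteq> perturb \<phi> L y)"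
    by (elim exE) (rule that, drule (1) bspec)
  obtain F where F: "F \<subseteq> Y" "finite F" "Y \<subseteq> (\<Union>p\<in>F. N p)"
    using compactE_image[OF assms(5), of Y N] N by blast
  have "AE L in lebesgue. \<forall>p\<in>F. \<forall>y\<in>Y \<inter> N p. y \<noteq> x \<longrightarrow> perturb \<phi> L x \<noteq> perturb \<phi> L y"
    using F(1) N by (intro AE_finite_allI[OF F(2)]) blast
  moreover have "AE L in lebesgue. \<exists>c>0. \<exists>\<rho>>0. \<forall>y\<in>M \<inter> ball x \<rho>.
      c * norm (x - y) \<le> norm (perturb \<phi> L x - perturb \<phi> L y)"
    using assms by (intro AE_perturb_locally_expanding) auto
  ultimately show ?thesis
  proof (rule eventually_elim2)
    fix L assume inj: "\<forall>p\<in>F. \<forall>y\<in>Y \<inter> N p. y \<noteq> x \<longrightarrow> perturb \<phi> L x \<noteq> perturb \<phi> L y"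
      and "\<exists>c>0. \<exists>\<rho>>0. \<forall>y\<in>M \<inter> ball x \<rho>. c * norm (x - y) \<le> norm (perturb \<phi> L x - perturb \<phi> L y)"
    then obtain c \<rho> where c: "0 < c" "0 < \<rho>"
      "\<And>y. y \<in> M \<inter> ball x \<rho> \<Longrightarrow> c * norm (x - y) \<le> norm (perturb \<phi> L x - perturb \<phi> L y)" by blast
    let ?d = "\<lambda>y. norm (perturb \<phi> L x - perturb \<phi> L y)"
    have comp: "compact (Y - ball x \<rho>)"
      using assms(5) by (intro compact_diff) auto
    have "continuous_on (Y - ball x \<rho>) ?d"
      using Cr_on_continuous[OF Cr_on_perturb[OF assms(3)]] assms(6)
      by (intro continuous_intros) (auto intro: continuous_on_subset)
    then have "compact (?d ` (Y - ball x \<rho>))"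
      using comp by (rule compact_continuous_image)
    moreover have "0 \<notin> ?d ` (Y - ball x \<rho>)"
    proof
      assume "0 \<in> ?d ` (Y - ball x \<rho>)"
      then obtain y where y: "y \<in> Y" "y \<notin> ball x \<rho>" "perturb \<phi> L x = perturb \<phi> L y" by auto
      then have "y \<noteq> x" using c(2) by auto
      moreover obtain p where "p \<in> F" "y \<in> N p" using F(3) y(1) by blast
      ultimately show False using inj y by blast
    qed
    ultimately obtain \<delta> where \<delta>: "0 < \<delta>" "\<And>z. z \<in> ?d ` (Y - ball x \<rho>) \<Longrightarrow> \<delta> \<le> dist 0 z"
      using separate_point_closed[OF compact_imp_closed] by metis
    obtain B where B: "0 < B" "\<And>y. y \<in> Y \<Longrightarrow> norm (x - y) \<le> B"
    proof -
      have "bounded Y" using assms(5) compact_imp_bounded by blast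
      then obtain B where "\<And>y. y \<in> Y \<Longrightarrow> dist x y \<le> B" using bounded_any_center by metis
      then show ?thesis
        by (intro that[of "max B 1"]) (auto simp: dist_norm le_max_iff_disj)
    qed
    \<comment> \<open>The summand \<open>1 / c\<close> serves the ball around \<open>x\<close>, the
      summand \<open>B / \<delta>\<close> its complement.\<close>
    have "norm (x - y) \<le> (1 / c + B / \<delta>) * ?d y" if y: "y \<in> Y" for y
    proof (cases "y \<in> ball x \<rho>")
      case True
      then have "c * norm (x - y) \<le> ?d y" using c(3) y assms(6) by blast
      then have "norm (x - y) \<le> 1 / c * ?d y" using c(1) by (simp add: field_simps)
      moreover have "0 \<le> B / \<delta> * ?d y" using B \<delta> by simp
      ultimately show ?thesis by (simp add: distrib_right)
    next
      case False
      then have "\<delta> \<le> ?d y" using \<delta>(2)[of "?d y"] y by auto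
      then have "B \<le> B / \<delta> * ?d y" using \<delta>(1) B(1) by (simp add: field_simps)
      then have "norm (x - y) \<le> B / \<delta> * ?d y" using B(2)[OF y] by linarith
      moreover have "0 \<le> 1 / c * ?d y" using c(1) by simp
      ultimately show ?thesis by (simp add: distrib_right)
    qed
    moreover have "0 \<le> 1 / c + B / \<delta>" using B \<delta> c(1) by simp
    ultimately show "\<exists>C\<ge>0. \<forall>y\<in>Y. norm (x - y) \<le> C * ?d y" by blast
  qed
qed

section \<open>Inverse functions and local embeddings\<close>

text \<open>The derivative at \<open>u\<close> is normalised to the identity, which is then its own
  inverse in the \<open>C\<^sup>1\<close> theorem. That theorem asks for continuity of the
  derivative as a bounded operator; in finite dimension this can be checked direction by direction.
  \<open>n_times_C_on_inverse_map\<close> raises the smoothness of \<open>G\<close> to order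
  \<open>r\<close>.\<close>

lemma Cr_inverse_function:
  fixes F :: "real^'k \<Rightarrow> real^'k"
  assumes "Cr_on_open r S F" "1 \<le> r" "u \<in> S" "(F has_derivative (\<lambda>v. v)) (at u)"
  obtains U V G where "open U" "U \<subseteq> S" "u \<in> U" "open V" "F u \<in> V"
    "homeomorphism U V F G" "Cr_on_open r V G"
proof -
  note C1 = Cr_on_open_C1[OF assms(1,2)]
  have der: "(F has_derivative frechet_derivative F (at x)) (at x)" if "x \<in> S" for x
    by (rule n_times_C_on_SucD[OF C1 that])
  have bl: "blinfun_apply (Blinfun (frechet_derivative F (at x))) = frechet_derivative F (at x)"
    if "x \<in> S" for x
    by (rule bounded_linear_Blinfun_apply[OF has_derivative_bounded_linear[OF der[OF that]]])
  have cont: "continuous_on S (\<lambda>x. Blinfun (frechet_derivative F (at x)))"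
  proof (rule continuous_on_blinfun_componentwise)
    fix i :: "real^'k"
    have "continuous_on S (\<lambda>x. frechet_derivative F (at x) i)" using C1 by simp
    then show "continuous_on S (\<lambda>x. blinfun_apply (Blinfun (frechet_derivative F (at x))) i)"
      by (rule continuous_on_eq) (simp add: bl)
  qed
  have "frechet_derivative F (at u) = (\<lambda>v. v)"
    using frechet_derivative_at[OF assms(4)] by simp
  then have inv: "id_blinfun o\<^sub>L Blinfun (frechet_derivative F (at u)) = id_blinfun"
    using bl[OF assms(3)] by (intro blinfun_eqI) simp
  obtain U V G G' where U: "open U" "U \<subseteq> S" "u \<in> U" "open V" "F u \<in> V"
    and hom: "homeomorphism U V F G"
    and G: "\<And>y. y \<in> V \<Longrightarrow> (G has_derivative G' y) (at y)"
      "\<And>y. y \<in> V \<Longrightarrow> G' y = inv (blinfun_apply (Blinfun (frechet_derivative F (at (G y)))))"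
      "\<And>y. y \<in> V \<Longrightarrow> bij (blinfun_apply (Blinfun (frechet_derivative F (at (G y)))))"
    using inverse_function_theorem[OF Cr_on_open_imp_open[OF assms(1)] _ cont assms(3) inv]
      der bl by metis
  have GV: "G ` V \<subseteq> S" "continuous_on V G" "\<And>y. y \<in> V \<Longrightarrow> F (G y) = y"
    using hom U(2) by (auto simp: homeomorphism_def)
  have bij: "bij (frechet_derivative F (at (G y)))" if "y \<in> V" for y
    using G(3)[OF that] bl[of "G y"] GV(1) that by (simp add: image_subset_iff)
  have "Cr_on_open r V G"
  proof (rule Cr_on_open_if_n_times_C_on[OF U(4)])
    fix n assume n: "enat n \<le> r"
    show "n_times_C_on n V G"
      by (rule n_times_C_on_inverse_map[OF Cr_on_open_imp_open[OF assms(1)] U(4) GV bij G(1)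
            Cr_on_open_imp_n_times_C_on[OF assms(1) n]])
  qed
  then show ?thesis by (rule that[OF U hom])
qed

text \<open>Along a kernel vector \<open>f\<close> changes by less than any prescribed multiple of
  the displacement, which contradicts expansion. This extracts the immersion property from the
  estimate that survives Fubini.\<close>

lemma expanding_imp_derivative_injective:
  fixes f :: "'a::euclidean_space \<Rightarrow> 'b::euclidean_space"
  assumes "(f has_derivative D) (at q)" "subspace T" "t0 \<in> T" "D t0 = 0" "0 < d"
    and exp: "\<And>t. t \<in> T \<Longrightarrow> norm t < d \<Longrightarrow> norm t \<le> B * norm (f (q + t) - f q)"
  shows "t0 = 0"
proof (rule ccontr)
  assume "t0 \<noteq> 0"
  \<comment> \<open>Chosen so that |B| e < 1 for \<open>B\<close> of any sign, including 0.\<close>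
  define e where "e = 1 / (2 * (\<bar>B\<bar> + 1))"
  have "0 < e" by (simp add: e_def add_nonneg_pos)
  then obtain d' where d': "0 < d'"
    "\<And>y. norm (y - q) < d' \<Longrightarrow> norm (f y - f q - D (y - q)) \<le> e * norm (y - q)"
    using assms(1) unfolding has_derivative_at_alt by blast
  define s where "s = min d d' / (2 * norm t0)"
  define t where "t = s *\<^sub>R t0"
  have "0 < s" using assms(5) d'(1) \<open>t0 \<noteq> 0\<close> by (simp add: s_def)
  have nt: "norm t = min d d' / 2"
    using assms(5) d'(1) \<open>t0 \<noteq> 0\<close> by (simp add: t_def s_def)
  then have t: "norm t < d" "norm t < d'" "0 < norm t" using assms(5) d'(1) by auto
  have "D t = 0"
    using linear_scale[OF has_derivative_linear[OF assms(1)]] assms(4) by (simp add: t_def)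
  then have "norm (f (q + t) - f q) \<le> e * norm t"
    using d'(2)[of "q + t"] t(2) by simp
  then have "\<bar>B\<bar> * norm (f (q + t) - f q) \<le> \<bar>B\<bar> * (e * norm t)"
    by (rule mult_left_mono) simp
  moreover have "norm t \<le> B * norm (f (q + t) - f q)"
  proof (rule exp[OF _ t(1)])
    show "t \<in> T" unfolding t_def by (rule subspace_scale[OF assms(2,3)])
  qed
  moreover have "B * norm (f (q + t) - f q) \<le> \<bar>B\<bar> * norm (f (q + t) - f q)"
    by (intro mult_right_mono) auto
  ultimately have "norm t \<le> (\<bar>B\<bar> * e) * norm t" by simp
  then have "1 \<le> \<bar>B\<bar> * e" using t(3) by simp
  moreover have "\<bar>B\<bar> * e < 1"
  proof -
    have "0 < 2 * (\<bar>B\<bar> + 1)" "\<bar>B\<bar> < 2 * (\<bar>B\<bar> + 1)" using abs_ge_zero[of B] by simp_all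
    then have "\<bar>B\<bar> / (2 * (\<bar>B\<bar> + 1)) < 1" by (simp only: pos_divide_less_eq mult_1)
    then show ?thesis by (simp add: e_def)
  qed
  ultimately show False by simp
qed

text \<open>With \<open>f\<close> the map \<open>\<Phi>\<close> in a slice chart, \<open>D\<close> its derivative at \<open>q\<close> and \<open>\<iota>\<close> a left inverse
  of \<open>D\<close> on the slice \<open>T\<close>, the map \<open>F u = f (q + \<iota> u) + (u - D (\<iota> u))\<close> has derivative \<open>id\<close> at \<open>0\<close>
  and agrees with \<open>f (q + \<iota> u)\<close> on \<open>D ` T\<close>. Its local inverse flattens the image of \<open>\<Phi>\<close>.\<close>

lemma expanding_imp_local_embedding:
  fixes M :: "(real^'n) set" and \<Phi> :: "real^'n \<Rightarrow> real^'k"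
  assumes "1 \<le> r" "compact M" "embedded_Cr_submanifold r m M" "Cr_on r M \<Phi>" "x \<in> M"
    and "0 \<le> C" and exp: "\<And>y. y \<in> M \<Longrightarrow> norm (x - y) \<le> C * norm (\<Phi> x - \<Phi> y)"
  shows "\<exists>U V. openin (top_of_set M) U \<and> x \<in> U \<and> open V \<and> \<Phi> x \<in> V \<and>
    embedded_Cr_submanifold r m (V \<inter> \<Phi> ` M) \<and> Cr_diffeomorphism r U (V \<inter> \<Phi> ` M) \<Phi>"
proof -
  obtain W and \<psi> :: "real^'n \<Rightarrow> real^'n" and W' h T where W: "x \<in> W" "Cr_on_open r W \<psi>" "Cr_on_open r W' h"
    "\<And>x. x \<in> W \<Longrightarrow> \<psi> x \<in> W' \<and> h (\<psi> x) = x" "\<And>y. y \<in> W' \<Longrightarrow> h y \<in> W \<and> \<psi> (h y) = y"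
    "subspace T" "dim T = m" "\<And>x. x \<in> W \<Longrightarrow> x \<in> M \<longleftrightarrow> \<psi> x \<in> T"
    by (fact submanifold_chart[OF assms(3,5)])
  obtain W0 g where W0: "x \<in> W0" "Cr_on_open r W0 g" "\<And>y. y \<in> M \<inter> W0 \<Longrightarrow> g y = \<Phi> y"
    by (fact Cr_onE[OF assms(4,5)])
  note op = Cr_on_open_imp_open[OF W(2)] Cr_on_open_imp_open[OF W0(2)] Cr_on_open_imp_open[OF W(3)]
  define q where "q = \<psi> x"
  have q: "q \<in> W'" "h q = x" "q \<in> T"
    using W(1,4,8) assms(5) by (auto simp: q_def)
  \<comment> \<open>The part of the chart domain that \<open>h\<close> sends into the domain of the
    extension \<open>g\<close>, so that \<open>f\<close> is \<open>C\<^sup>r\<close> on an open set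
    and not merely on the slice.\<close>
  define \<Omega> where "\<Omega> = W' \<inter> h -` W0"
  have \<Omega>: "open \<Omega>" "q \<in> \<Omega>" "\<Omega> \<subseteq> W'"
    using continuous_open_preimage[OF Cr_on_open_continuous[OF W(3)] op(3,2)] q W0(1)
    by (auto simp: \<Omega>_def)
  note h\<Omega> = Cr_on_open_subset[OF W(3) \<Omega>(1,3)]
  define f where "f t = g (h t)" for t
  have f: "Cr_on_open r \<Omega> f"
    unfolding f_def by (rule Cr_on_open_compose[OF h\<Omega> W0(2)]) (auto simp: \<Omega>_def)
  have slice: "h t \<in> M" "h t \<in> W" "\<psi> (h t) = t" "f t = \<Phi> (h t)" if "t \<in> T" "t \<in> \<Omega>" for t
  proof -
    show *: "h t \<in> W" "\<psi> (h t) = t" using W(5) \<Omega>(3) that(2) by blast+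
    then show "h t \<in> M" using W(8) that(1) by simp
    then show "f t = \<Phi> (h t)" using W0(3) that(2) by (simp add: f_def \<Omega>_def)
  qed
  have fq: "f q = \<Phi> x" using slice(4)[OF q(3) \<Omega>(2)] q(2) by simp
  define D where "D = frechet_derivative f (at q)"
  have D: "(f has_derivative D) (at q)"
    unfolding D_def by (rule Cr_on_open_has_derivative[OF f assms(1) \<Omega>(2)])
  then have linD: "linear D" by (rule has_derivative_linear)
  \<comment> \<open>In chart coordinates the expanding estimate holds with constant
    \<open>K * C\<close>, where \<open>K\<close> is a Lipschitz constant of \<psi> near
    \<open>x\<close>.\<close>
  have D_inj: "t = 0" if "t \<in> T" "D t = 0" for t
  proof -
    obtain K \<rho> where K: "0 \<le> K" "0 < \<rho>" "cball x \<rho> \<subseteq> W"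
      "\<And>y z. y \<in> cball x \<rho> \<Longrightarrow> z \<in> cball x \<rho> \<Longrightarrow> norm (\<psi> y - \<psi> z) \<le> K * norm (y - z)"
      by (fact Cr_on_open_locally_Lipschitz[OF W(2) assms(1) W(1)])
    have "open (\<Omega> \<inter> h -` ball x \<rho>)"
      by (rule continuous_open_preimage[OF Cr_on_open_continuous[OF h\<Omega>] \<Omega>(1) open_ball])
    moreover have "q \<in> \<Omega> \<inter> h -` ball x \<rho>" using \<Omega>(2) q(2) K(2) by simp
    ultimately obtain d where d: "0 < d" "ball q d \<subseteq> \<Omega> \<inter> h -` ball x \<rho>"
      using open_contains_ball by blast
    show "t = 0"
    proof (rule expanding_imp_derivative_injective[OF D W(6) that d(1)])
      fix s assume s: "s \<in> T" "norm s < d"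
      then have "q + s \<in> ball q d" by (simp add: dist_norm)
      then have s': "q + s \<in> \<Omega>" "h (q + s) \<in> cball x \<rho>" using d(2) by auto
      have sT: "q + s \<in> T" using W(6) q(3) s(1) by (rule subspace_add)
      have "norm s = norm (\<psi> (h (q + s)) - \<psi> x)"
        using slice(3)[OF sT s'(1)] by (simp add: q_def)
      also have "\<dots> \<le> K * norm (h (q + s) - x)"
        using K(2) s'(2) by (intro K(4)) auto
      also have "\<dots> \<le> K * (C * norm (\<Phi> x - \<Phi> (h (q + s))))"
        using exp[OF slice(1)[OF sT s'(1)]] K(1) by (intro mult_left_mono) (simp_all add: norm_minus_commute)
      also have "\<dots> = (K * C) * norm (f (q + s) - f q)"
        using slice(4)[OF sT s'(1)] fq by (simp add: norm_minus_commute)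
      finally show "norm s \<le> (K * C) * norm (f (q + s) - f q)" .
    qed
  qed
  have inj: "inj_on D T"
  proof (rule inj_onI)
    fix a b assume ab: "a \<in> T" "b \<in> T" "D a = D b"
    then have "D (a - b) = 0" by (simp add: linear_diff[OF linD])
    then show "a = b" using D_inj[OF subspace_diff[OF W(6) ab(1,2)]] by simp
  qed
  \<comment> \<open>The range condition keeps \<open>q + \<iota> u\<close> on the slice for every
    \<open>u\<close>, so its image under \<open>h\<close> lies in \<open>M\<close> once it is in
    \<Omega>.\<close>
  obtain \<iota> where \<iota>: "range \<iota> \<subseteq> T" "linear \<iota>" "\<forall>t\<in>T. \<iota> (D t) = t"
    using linear_exists_left_inverse_on[OF linD W(6) inj] by blast
  have \<iota>T: "q + \<iota> u \<in> T" for u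
    using \<iota>(1) by (intro subspace_add[OF W(6) q(3)]) auto
  have bl\<iota>: "bounded_linear \<iota>" using \<iota>(2) by (simp add: linear_conv_bounded_linear)
  define P where "P u = u - D (\<iota> u)" for u
  have blP: "bounded_linear P"
    unfolding P_def using linD \<iota>(2)
    by (intro bounded_linear_sub bounded_linear_ident bounded_linear_compose[of D, OF _ bl\<iota>])
      (simp add: linear_conv_bounded_linear)
  define S where "S = (\<lambda>u. q + \<iota> u) -` \<Omega>"
  have cont\<iota>: "continuous_on UNIV (\<lambda>u. q + \<iota> u)"
    by (intro continuous_intros linear_continuous_on bl\<iota>)
  have S: "open S"
    unfolding S_def using continuous_open_preimage[OF cont\<iota> open_UNIV \<Omega>(1)] by simp
  have zero: "\<iota> 0 = 0" "D 0 = 0" "P 0 = 0" using linear_0[OF \<iota>(2)] linear_0[OF linD] by (simp_all add: P_def)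
  then have "0 \<in> S" using \<Omega>(2) by (simp add: S_def)
  have q\<iota>: "Cr_on_open r V (\<lambda>u. q + \<iota> u)" if "open V" for V
    by (rule Cr_on_open_add[OF Cr_on_open_const[OF that] Cr_on_open_bounded_linear[OF bl\<iota> that]])
  define F where "F u = f (q + \<iota> u) + P u" for u
  have F: "Cr_on_open r S F"
    unfolding F_def
    by (rule Cr_on_open_add[OF Cr_on_open_compose[OF q\<iota>[OF S] f] Cr_on_open_bounded_linear[OF blP S]])
      (auto simp: S_def)
  have dF: "(F has_derivative (\<lambda>v. v)) (at 0)"
  proof -
    have "((\<lambda>u. q + \<iota> u) has_derivative (\<lambda>v. 0 + \<iota> v)) (at 0)"
      by (intro has_derivative_add has_derivative_const bounded_linear_imp_has_derivative bl\<iota>)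
    then have "((\<lambda>u. q + \<iota> u) has_derivative \<iota>) (at 0)" by simp
    moreover have "(f has_derivative D) (at (q + \<iota> 0))" using D zero by simp
    ultimately have "((\<lambda>u. f (q + \<iota> u)) has_derivative (\<lambda>v. D (\<iota> v))) (at 0)"
      by (rule has_derivative_compose)
    then have "(F has_derivative (\<lambda>v. D (\<iota> v) + P v)) (at 0)"
      unfolding F_def by (intro has_derivative_add bounded_linear_imp_has_derivative blP)
    then show ?thesis by (simp add: P_def)
  qed
  obtain U1 V1 G where U1: "open U1" "U1 \<subseteq> S" "0 \<in> U1" "open V1" "F 0 \<in> V1"
    "homeomorphism U1 V1 F G" "Cr_on_open r V1 G"
    by (fact Cr_inverse_function[OF F assms(1) \<open>0 \<in> S\<close> dF])
  have GF: "G (F u) = u" "F u \<in> V1" if "u \<in> U1" for u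
    using U1(6) that by (auto simp: homeomorphism_def)
  have FG: "F (G y) = y" "G y \<in> U1" if "y \<in> V1" for y
    using U1(6) that by (auto simp: homeomorphism_def)
  define T' where "T' = D ` T"
  have T': "subspace T'" "dim T' = m"
    unfolding T'_def using linear_subspace_image[OF linD W(6)] dim_image_eq[OF linD, of T] inj W(6,7)
    by (simp_all add: span_eq_iff[THEN iffD2])
  have P0: "P u = 0" if "u \<in> T'" for u
    using that \<iota>(3) by (auto simp: T'_def P_def)
  \<comment> \<open>Points of \<open>M\<close> in \<open>N\<close> have slice coordinates whose
    linearised image lies in \<open>U1\<close>, where \<open>G\<close> inverts
    \<open>F\<close>.\<close>
  define N where "N = W \<inter> \<psi> -` (\<Omega> \<inter> (\<lambda>t. D (t - q)) -` U1)"
  have "open N"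
  proof -
    have "continuous_on UNIV (\<lambda>t. D (t - q))"
      by (rule bounded_linear.continuous_on[OF has_derivative_bounded_linear[OF D]])
        (intro continuous_intros)
    then have "open (\<Omega> \<inter> (\<lambda>t. D (t - q)) -` U1)"
      using continuous_open_preimage[OF continuous_on_subset[OF _ subset_UNIV] \<Omega>(1) U1(1)] by blast
    then show ?thesis
      unfolding N_def by (rule continuous_open_preimage[OF Cr_on_open_continuous[OF W(2)] op(1)])
  qed
  have "x \<in> N" using W(1) \<Omega>(2) U1(3) zero by (simp add: N_def q_def)
  have cont\<Phi>: "continuous_on M \<Phi>" by (rule Cr_on_continuous[OF assms(4)])
  \<comment> \<open>After this removal every point of \<open>M\<close> sent into \<open>V\<close>
    lies in \<open>N\<close>, so distant sheets of \<open>M\<close> cannot meet the image near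
    \<open>\<Phi> x\<close>. The removed set is closed by compactness and misses
    \<open>\<Phi> x\<close> by the estimate.\<close>
  define V where "V = V1 - \<Phi> ` (M - N)"
  have "open V"
  proof -
    have "compact (M - N)" using assms(2) \<open>open N\<close> by (rule compact_diff)
    then have "compact (\<Phi> ` (M - N))"
      by (intro compact_continuous_image continuous_on_subset[OF cont\<Phi>]) auto
    then show ?thesis
      unfolding V_def using U1(4) by (intro open_Diff compact_imp_closed)
  qed
  have "F 0 = \<Phi> x" using fq zero by (simp add: F_def)
  have "\<Phi> x \<in> V"
  proof -
    have "\<Phi> x \<notin> \<Phi> ` (M - N)"
    proof
      assume "\<Phi> x \<in> \<Phi> ` (M - N)"
      then obtain y where y: "y \<in> M" "y \<notin> N" "\<Phi> x = \<Phi> y" by blast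
      then have "norm (x - y) \<le> 0" using exp[OF y(1)] by simp
      then show False using y(2) \<open>x \<in> N\<close> by simp
    qed
    then show ?thesis using U1(5) \<open>F 0 = \<Phi> x\<close> by (simp add: V_def)
  qed
  define U where "U = M \<inter> \<Phi> -` V"
  have U: "openin (top_of_set M) U" "x \<in> U" "U \<subseteq> M"
    unfolding U_def using continuous_openin_preimage_gen[OF cont\<Phi> \<open>open V\<close>] \<open>\<Phi> x \<in> V\<close> assms(5) by auto
  have image: "\<Phi> ` U = V \<inter> \<Phi> ` M" by (auto simp: U_def)
  \<comment> \<open>A \<open>C\<^sup>r\<close> map on all of \<open>V\<close> that inverts \<Phi> on
    the image; \<open>Cr_on\<close> asks for such an ambient extension of
    \<open>inv_into\<close>.\<close>
  define H where "H z = h (q + \<iota> (G z))" for z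
  have recover: "G (\<Phi> y) \<in> T'" "H (\<Phi> y) = y" if "y \<in> U" for y
  proof -
    have y: "y \<in> M" "\<Phi> y \<in> V" using that by (auto simp: U_def)
    then have "y \<in> N" by (auto simp: V_def)
    then have N: "y \<in> W" "\<psi> y \<in> \<Omega>" "D (\<psi> y - q) \<in> U1" by (auto simp: N_def)
    then have "\<psi> y \<in> T" using W(8) y(1) by blast
    then have t: "\<psi> y - q \<in> T" using W(6) q(3) by (intro subspace_diff)
    let ?u = "D (\<psi> y - q)"
    have u: "?u \<in> T'" using t by (simp add: T'_def)
    have \<iota>u: "q + \<iota> ?u = \<psi> y" using \<iota>(3) t by simp
    have "F ?u = \<Phi> y"
      using slice(4)[OF \<open>\<psi> y \<in> T\<close> N(2)] W(4)[OF N(1)] by (simp add: F_def \<iota>u P0[OF u])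
    then have "G (\<Phi> y) = ?u" using GF(1)[OF N(3)] by simp
    with u \<iota>u show "G (\<Phi> y) \<in> T'" "H (\<Phi> y) = y"
      using W(4)[OF N(1)] by (simp_all add: H_def)
  qed
  \<comment> \<open>On \<open>T'\<close> the correction \<open>P\<close> vanishes, so there
    \<open>F\<close> takes values in the image of \<open>M\<close>. Hence the image fills the whole
    slice and not just a part of it.\<close>
  have forth: "z \<in> \<Phi> ` M" if "z \<in> V" "G z \<in> T'" for z
  proof -
    have "z \<in> V1" using that(1) by (simp add: V_def)
    note FG = FG[OF this]
    then have "q + \<iota> (G z) \<in> \<Omega>" using U1(2) by (auto simp: S_def)
    note s = slice[OF \<iota>T this]
    have "F (G z) = \<Phi> (h (q + \<iota> (G z)))"
      using s(4) P0[OF that(2)] by (simp add: F_def)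
    then show ?thesis using s(1) FG(1) by (metis imageI)
  qed
  have "bij_betw \<Phi> U (V \<inter> \<Phi> ` M)"
    unfolding bij_betw_def image using recover(2) by (auto intro: inj_on_inverseI)
  have inv: "inv_into U \<Phi> z = H z" if z: "z \<in> V \<inter> \<Phi> ` M" for z
  proof -
    obtain y where "y \<in> U" "z = \<Phi> y" using z image by blast
    then show ?thesis
      using recover(2) bij_betw_inv_into_left[OF \<open>bij_betw \<Phi> U (V \<inter> \<Phi> ` M)\<close>] by simp
  qed
  have "V \<subseteq> V1" by (auto simp: V_def)
  note GV = Cr_on_open_subset[OF U1(7) \<open>open V\<close> this]
  have "Cr_on_open r V (\<lambda>z. q + \<iota> (G z))"
    by (rule Cr_on_open_compose[OF GV q\<iota>[OF open_UNIV]]) simp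
  then have "Cr_on_open r V H"
    unfolding H_def
  proof (rule Cr_on_open_compose[OF _ h\<Omega>])
    show "(\<lambda>z. q + \<iota> (G z)) ` V \<subseteq> \<Omega>"
      using FG(2) U1(2) \<open>V \<subseteq> V1\<close> by (auto simp: S_def)
  qed
  then have "Cr_on r (V \<inter> \<Phi> ` M) (inv_into U \<Phi>)"
    by (rule Cr_onI) (auto simp: inv)
  then have diffeo: "Cr_diffeomorphism r U (V \<inter> \<Phi> ` M) \<Phi>"
    unfolding Cr_diffeomorphism_def
    using \<open>bij_betw \<Phi> U (V \<inter> \<Phi> ` M)\<close> Cr_on_subset[OF assms(4) U(3)] by (intro conjI)
  have GVim: "G ` V = U1 \<inter> F -` V"
  proof
    show "G ` V \<subseteq> U1 \<inter> F -` V" using FG \<open>V \<subseteq> V1\<close> by auto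
    show "U1 \<inter> F -` V \<subseteq> G ` V" using GF(1) by force
  qed
  have FU1: "Cr_on_open r U1 F" by (rule Cr_on_open_subset[OF F U1(1,2)])
  have "open (G ` V)"
    unfolding GVim by (rule continuous_open_preimage[OF Cr_on_open_continuous[OF FU1] U1(1) \<open>open V\<close>])
  have G_bij: "bij_betw G V (G ` V)"
    unfolding bij_betw_def using FG(1) \<open>V \<subseteq> V1\<close> by (auto intro: inj_on_inverseI)
  have G_inv: "F u = inv_into V G u" if u: "u \<in> G ` V" for u
  proof -
    obtain z where z: "z \<in> V" "u = G z" using u by blast
    then show ?thesis
      using bij_betw_inv_into_left[OF G_bij z(1)] FG(1)[of z] \<open>V \<subseteq> V1\<close> by auto
  qed
  have chart: "Cr_diffeomorphism r V (G ` V) G"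
    unfolding Cr_diffeomorphism_def
  proof (intro conjI G_bij)
    show "Cr_on r V G" by (rule Cr_onI[OF GV]) simp_all
    show "Cr_on r (G ` V) (inv_into V G)"
      by (rule Cr_onI[OF FU1 _ G_inv]) (simp_all add: GVim)
  qed
  have flat: "G ` ((V \<inter> \<Phi> ` M) \<inter> V) = T' \<inter> G ` V"
  proof
    show "G ` ((V \<inter> \<Phi> ` M) \<inter> V) \<subseteq> T' \<inter> G ` V"
    proof
      fix u assume "u \<in> G ` ((V \<inter> \<Phi> ` M) \<inter> V)"
      then obtain z where z: "z \<in> V \<inter> \<Phi> ` M" "u = G z" by blast
      then obtain y where "y \<in> U" "z = \<Phi> y" using image by blast
      then show "u \<in> T' \<inter> G ` V" using z recover(1) by auto
    qed
    show "T' \<inter> G ` V \<subseteq> G ` ((V \<inter> \<Phi> ` M) \<inter> V)" using forth by auto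
  qed
  \<comment> \<open>The single chart \<open>G\<close> on \<open>V\<close> serves at every point of
    the image.\<close>
  have "embedded_Cr_submanifold r m (V \<inter> \<Phi> ` M)"
    unfolding embedded_Cr_submanifold_def
  proof
    fix p assume "p \<in> V \<inter> \<Phi> ` M"
    then have "p \<in> V" by blast
    then show "\<exists>W W' \<psi> T. open W \<and> p \<in> W \<and> open (W' :: (real^'k) set) \<and> Cr_diffeomorphism r W W' \<psi> \<and>
        subspace T \<and> dim T = m \<and> \<psi> ` (V \<inter> \<Phi> ` M \<inter> W) = T \<inter> W'"
      by (intro exI[of _ V] exI[of _ "G ` V"] exI[of _ G] exI[of _ T'] conjI
          \<open>open V\<close> \<open>open (G ` V)\<close> chart T' flat)
  qed
  then show ?thesis
    by (intro exI[of _ U] exI[of _ V] conjI U(1,2) \<open>open V\<close> \<open>\<Phi> x \<in> V\<close> diffeo)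
qed

theorem theorem3p1:
  fixes r :: enat and m :: nat
    and M X :: "(real^'n) set"
    and \<mu> :: "(real^'n) measure"
    and \<phi> :: "real^'n \<Rightarrow> real^'k"
  assumes "1 \<le> r"
    and "compact M" and "embedded_Cr_submanifold r m M"
    and "X \<subseteq> M" and "compact X"
    and "prob_space \<mu>" and "sets \<mu> = sets (restrict_space borel X)"
    and "Cr_on r M \<phi>"
  shows "AE L in (lebesgue :: (real^'n^'k) measure).
    (hausdorff_measure CARD('k) X = 0 \<and> m \<le> CARD('k) \<longrightarrow>
      (AE x in \<mu>. \<exists>C\<ge>0. \<forall>y\<in>X.
        norm (x - y) \<le> C * norm (perturb \<phi> L x - perturb \<phi> L y))) \<and>
    (m < CARD('k) \<longrightarrow>
      (AE x in \<mu>. \<exists>U V.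
        openin (top_of_set M) U \<and> x \<in> U \<and>
        open V \<and> perturb \<phi> L x \<in> V \<and>
        embedded_Cr_submanifold r m (V \<inter> perturb \<phi> L ` M) \<and>
        Cr_diffeomorphism r U (V \<inter> perturb \<phi> L ` M) (perturb \<phi> L)))"
proof -
  have X: "X \<in> sets borel" using assms(5) by (simp add: borel_compact)
  have sp: "space \<mu> = X"
    using sets_eq_imp_space_eq[OF assms(7)] by (simp add: space_restrict_space)
  have cont: "continuous_on M \<phi>" by (rule Cr_on_continuous[OF assms(8)])
  have 1: "AE L in lebesgue. AE x in \<mu>. \<exists>C\<ge>0. \<forall>y\<in>X. norm (x - y) \<le> C * norm (perturb \<phi> L x - perturb \<phi> L y)"
    if "hausdorff_measure CARD('k) X = 0" "m \<le> CARD('k)"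
  proof (rule AE_perturb_expanding_Fubini[OF assms(5) subset_refl X continuous_on_subset[OF cont assms(4)] assms(6,7)])
    fix x assume x: "x \<in> X"
    have "hausdorff_null CARD('k) X"
      using that(1) by (rule hausdorff_null_if_measure_0) simp
    \<comment> \<open>Here \<open>X\<close> is null as a whole, so the neighbourhood can be the
      entire space.\<close>
    then have "\<exists>W. open W \<and> p \<in> W \<and> hausdorff_null CARD('k) (X \<inter> W)" for p
      by (intro exI[of _ UNIV]) simp
    then show "AE L in lebesgue. \<exists>C\<ge>0. \<forall>y\<in>X. norm (x - y) \<le> C * norm (perturb \<phi> L x - perturb \<phi> L y)"
      by (rule AE_perturb_expanding_at[OF assms(1,3,8) that(2) assms(5,4) x])
  qed
  have 2: "AE L in lebesgue. AE x in \<mu>. \<exists>C\<ge>0. \<forall>y\<in>M. norm (x - y) \<le> C * norm (perturb \<phi> L x - perturb \<phi> L y)"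
    if "m < CARD('k)"
  proof (rule AE_perturb_expanding_Fubini[OF assms(2,4) X cont assms(6,7)])
    fix x assume "x \<in> X"
    then have x: "x \<in> M" using assms(4) by blast
    show "AE L in lebesgue. \<exists>C\<ge>0. \<forall>y\<in>M. norm (x - y) \<le> C * norm (perturb \<phi> L x - perturb \<phi> L y)"
      by (rule AE_perturb_expanding_at[OF assms(1,3,8) less_imp_le[OF that] assms(2) subset_refl x
            submanifold_locally_hausdorff_null[OF assms(3,1) _ that]])
  qed
  \<comment> \<open>This implication is deterministic: it holds for every \<open>L\<close> and every
    \<open>x\<close> that satisfy the estimate.\<close>
  have 3: "\<exists>U V. openin (top_of_set M) U \<and> x \<in> U \<and> open V \<and> perturb \<phi> L x \<in> V \<and>
        embedded_Cr_submanifold r m (V \<inter> perturb \<phi> L ` M) \<and>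
        Cr_diffeomorphism r U (V \<inter> perturb \<phi> L ` M) (perturb \<phi> L)"
    if x: "x \<in> space \<mu>" and C: "\<exists>C\<ge>0. \<forall>y\<in>M. norm (x - y) \<le> C * norm (perturb \<phi> L x - perturb \<phi> L y)" for x L
  proof -
    have "x \<in> M" using x sp assms(4) by blast
    obtain C where "0 \<le> C" and exp: "\<forall>y\<in>M. norm (x - y) \<le> C * norm (perturb \<phi> L x - perturb \<phi> L y)"
      using C by blast
    show ?thesis
      by (rule expanding_imp_local_embedding[OF assms(1-3) Cr_on_perturb[OF assms(8)] \<open>x \<in> M\<close> \<open>0 \<le> C\<close>])
        (rule bspec[OF exp])
  qed
  \<comment> \<open>The premises of both statements do not mention \<open>L\<close>, so the case
    distinction can be made outside the almost-everywhere quantifier.\<close>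
  have "AE L in lebesgue. hausdorff_measure CARD('k) X = 0 \<and> m \<le> CARD('k) \<longrightarrow>
      (AE x in \<mu>. \<exists>C\<ge>0. \<forall>y\<in>X. norm (x - y) \<le> C * norm (perturb \<phi> L x - perturb \<phi> L y))"
  proof (cases "hausdorff_measure CARD('k) X = 0 \<and> m \<le> CARD('k)")
    case True
    with 1 have "AE L in lebesgue. AE x in \<mu>. \<exists>C\<ge>0. \<forall>y\<in>X.
        norm (x - y) \<le> C * norm (perturb \<phi> L x - perturb \<phi> L y)" by blast
    then show ?thesis by (rule eventually_mono) blast
  next
    case False
    then show ?thesis by (intro always_eventually allI impI) blast
  qed
  moreover have "AE L in lebesgue. m < CARD('k) \<longrightarrow>
      (AE x in \<mu>. \<exists>U V. openin (top_of_set M) U \<and> x \<in> U \<and> open V \<and> perturb \<phi> L x \<in> V \<and>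
        embedded_Cr_submanifold r m (V \<inter> perturb \<phi> L ` M) \<and>
        Cr_diffeomorphism r U (V \<inter> perturb \<phi> L ` M) (perturb \<phi> L))"
  proof (cases "m < CARD('k)")
    case True
    from 2[OF this] show ?thesis
    proof (rule eventually_mono, intro impI)
      fix L assume "AE x in \<mu>. \<exists>C\<ge>0. \<forall>y\<in>M. norm (x - y) \<le> C * norm (perturb \<phi> L x - perturb \<phi> L y)"
      with AE_space[of \<mu>]
      show "AE x in \<mu>. \<exists>U V. openin (top_of_set M) U \<and> x \<in> U \<and> open V \<and> perturb \<phi> L x \<in> V \<and>
        embedded_Cr_submanifold r m (V \<inter> perturb \<phi> L ` M) \<and>
        Cr_diffeomorphism r U (V \<inter> perturb \<phi> L ` M) (perturb \<phi> L)"
        by (rule eventually_elim2) (rule 3)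
    qed
  qed simp
  ultimately show ?thesis by (rule eventually_conj)
qed

end
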